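(* Assume that the BDF2 kernels $b^{(n)}_{n-k}$ are positive semi-definite (or that the sufficient condition $0<r_k\le\frac{3+\sqrt{17}}{2}$ for $2\le k\le N$ holds) and that the maximum time-step size satisfies $\tau\le1/(4\kappa^* )$. Let $u$ be the solution of the diffusion problem. (1) The solution $u^n$ of the adaptive BDF2 scheme (with BDF1 first step) satisfies, for $1\le n\le N$, $$\|u(t_n)-u^{n}\|\le2\exp(4\kappa^{*}t_{n-1})\Big(\|u_0-u^{0}\|+2t_n\int_{0}^{t_1}\|\partial_{tt}u\|\,dt+3t_n\max_{1\le j\le n}\tau_j\int_{t_{j-1}}^{t_j}\|\partial_{ttt}u\|\,dt\Big).$$ (2) If the BDF1 first step is replaced by some other (high-order) starting scheme producing $u^1$, the scheme being unchanged for $2\le n\le N$, then for $2\le n\le N$, $$\|u(t_n)-u^{n}\|\le2\exp(4\kappa^{*}t_{n-1})\Big(\|u(t_1)-u^{1}\|+2t_n\Big\|\frac{(u(t_1)-u^1)-(u(t_0)-u^0)}{\tau_1}\Big\|+3t_n\max_{1\le j\le n}\tau_j\int_{t_{j-1}}^{t_j}\|\partial_{ttt}u\|\,dt\Big).$$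
   Context: Let $\Omega$ be a bounded convex domain with smooth boundary, $\varepsilon>0$ a constant, $\kappa=\kappa(x)$ a smooth function on $\Omega$ with $|\kappa(x)|\le\kappa^*$ for a constant $\kappa^*>0$, $T>0$. $\langle\cdot,\cdot\rangle$ and $\|\cdot\|$ are the $L^2(\Omega)$ inner product and norm. Diffusion problem: $\partial_tu-\varepsilon\Delta u=\kappa(x)u+f(t,x)$ for $x\in\Omega$, $0<t<T$, with $u=0$ on $\partial\Omega$ and $u(0,x)=u_0(x)$. The solution $u$ and the force $f$ are assumed sufficiently smooth (e.g. $u\in C^3([0,T];L^2(\Omega))\cap C([0,T];H^2(\Omega)\cap H^1_0(\Omega))$, $f\in C([0,T];L^2(\Omega))$, with the equation also valid at $t=T$). Time mesh: $0=t_0<t_1<\cdots<t_N=T$, $\tau_k=t_k-t_{k-1}$ for $1\le k\le N$, $\tau=\max_{1\le k\le N}\tau_k$, $r_k=\tau_k/\tau_{k-1}$ for $2\le k\le N$. BDF2 kernels: $b^{(1)}_0=1/\tau_1$ and, for $2\le n\le N$, $$b^{(n)}_0=\frac{1+2r_n}{\tau_n(1+r_n)},\quad b^{(n)}_1=-\frac{r_n^2}{\tau_n(1+r_n)},\quad b^{(n)}_j=0\ \ (2\le j\le n-1).$$ They are called positive semi-definite if $\sum_{k=1}^nw_k\sum_{j=1}^kb_{k-j}^{(k)}w_j\ge0$ for every $1\le n\le N$ and all real $w_1,\dots,w_n$. BDF2 operator: $D_2v^n=\sum_{k=1}^nb^{(n)}_{n-k}(v^k-v^{k-1})$ for $1\le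 n\le N$; thus $D_2v^1=(v^1-v^0)/\tau_1$ is the BDF1 formula. Adaptive BDF2 scheme: given $u^0\in L^2(\Omega)$ (an approximation of $u_0$) and $f^n=f(t_n,\cdot)$, the functions $u^n\in H_0^1(\Omega)$ satisfy, for $1\le n\le N$, $$\langle D_2u^{n},w\rangle+\varepsilon\langle\nabla u^{n},\nabla w\rangle=\langle\kappa u^{n},w\rangle+\langle f^n,w\rangle\qquad\text{for all }w\in H_0^1(\Omega).$$ In part (2) this equation is required only for $2\le n\le N$, and $u^1\in L^2(\Omega)$ is given by the other starting scheme. *)

theory Defs
  imports "HOL-Analysis.Analysis"
begin

section \<open>Smooth functions and smooth domains\<close>

text \<open>Intended for open \<open>S\<close> only: \<open>k\<close>-fold continuous differentiability,
  by recursion on the partial derivatives.\<close>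

fun Ck_on :: "nat \<Rightarrow> 'a::euclidean_space set \<Rightarrow> ('a \<Rightarrow> real) \<Rightarrow> bool" where
  "Ck_on 0 S f \<longleftrightarrow> continuous_on S f"
| "Ck_on (Suc k) S f \<longleftrightarrow> (\<forall>x\<in>S. f differentiable (at x)) \<and>
     (\<forall>b\<in>Basis. Ck_on k S (\<lambda>x. frechet_derivative f (at x) b))"

definition smooth_on :: "'a::euclidean_space set \<Rightarrow> ('a \<Rightarrow> real) \<Rightarrow> bool" where
  "smooth_on S f \<longleftrightarrow> (\<forall>k. Ck_on k S f)"

definition grad :: "('a::euclidean_space \<Rightarrow> real) \<Rightarrow> 'a \<Rightarrow> 'a" where
  "grad f x = (\<Sum>b\<in>Basis. frechet_derivative f (at x) b *\<^sub>R b)"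

text \<open>Near every boundary point the set is the sublevel set of a smooth function without critical
  points; the boundary is then locally the zero set of that function.\<close>

definition smooth_boundary :: "'a::euclidean_space set \<Rightarrow> bool" where
  "smooth_boundary \<Omega> \<longleftrightarrow> (\<forall>p\<in>frontier \<Omega>. \<exists>W g. open W \<and> p \<in> W \<and> smooth_on W g \<and>
     (\<forall>x\<in>W. grad g x \<noteq> 0) \<and> \<Omega> \<inter> W = {x\<in>W. g x < 0})"

section \<open>Lebesgue and Sobolev spaces\<close>

text \<open>Elements of \<open>L2 \<Omega>\<close> are represented by functions on the whole space whose values
  outside \<open>\<Omega>\<close> are irrelevant; equality in \<open>L2 \<Omega>\<close> is equality almost everywhere on \<open>\<Omega>\<close>.
  The codomain is a Euclidean space so that gradients are covered as well.\<close>

definition L2 :: "'a::euclidean_space set \<Rightarrow> ('a \<Rightarrow> 'b::euclidean_space) set" where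
  "L2 \<Omega> = {v. v \<in> borel_measurable (lebesgue_on \<Omega>) \<and>
              integrable (lebesgue_on \<Omega>) (\<lambda>x. (norm (v x))\<^sup>2)}"

definition L2_inner ::
    "'a::euclidean_space set \<Rightarrow> ('a \<Rightarrow> 'b::euclidean_space) \<Rightarrow> ('a \<Rightarrow> 'b) \<Rightarrow> real" where
  "L2_inner \<Omega> v w = (LINT x|lebesgue_on \<Omega>. v x \<bullet> w x)"

definition L2_norm :: "'a::euclidean_space set \<Rightarrow> ('a \<Rightarrow> 'b::euclidean_space) \<Rightarrow> real" where
  "L2_norm \<Omega> v = sqrt (L2_inner \<Omega> v v)"

definition test_functions :: "'a::euclidean_space set \<Rightarrow> ('a \<Rightarrow> real) set" where
  "test_functions \<Omega> = {\<phi>. smooth_on UNIV \<phi> \<and>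
     compact (closure {x. \<phi> x \<noteq> 0}) \<and> closure {x. \<phi> x \<noteq> 0} \<subseteq> \<Omega>}"

definition has_weak_gradient ::
    "'a::euclidean_space set \<Rightarrow> ('a \<Rightarrow> real) \<Rightarrow> ('a \<Rightarrow> 'a) \<Rightarrow> bool" where
  "has_weak_gradient \<Omega> v G \<longleftrightarrow> v \<in> L2 \<Omega> \<and> G \<in> L2 \<Omega> \<and>
     (\<forall>\<phi>\<in>test_functions \<Omega>. \<forall>b\<in>Basis.
        (LINT x|lebesgue_on \<Omega>. v x * (grad \<phi> x \<bullet> b)) =
        - (LINT x|lebesgue_on \<Omega>. (G x \<bullet> b) * \<phi> x))"

text \<open>On an open set the weak gradient is unique up to null sets, so the choice below only fixes
  a representative.\<close>

definition weak_grad :: "'a::euclidean_space set \<Rightarrow> ('a \<Rightarrow> real) \<Rightarrow> 'a \<Rightarrow> 'a" where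
  "weak_grad \<Omega> v = (SOME G. has_weak_gradient \<Omega> v G)"

definition H1 :: "'a::euclidean_space set \<Rightarrow> ('a \<Rightarrow> real) set" where
  "H1 \<Omega> = {v. \<exists>G. has_weak_gradient \<Omega> v G}"

definition H1_norm :: "'a::euclidean_space set \<Rightarrow> ('a \<Rightarrow> real) \<Rightarrow> real" where
  "H1_norm \<Omega> v = sqrt ((L2_norm \<Omega> v)\<^sup>2 + (L2_norm \<Omega> (weak_grad \<Omega> v))\<^sup>2)"

text \<open>The closure of the test functions in the norm of \<open>H1 \<Omega>\<close>.\<close>

definition H10 :: "'a::euclidean_space set \<Rightarrow> ('a \<Rightarrow> real) set" where
  "H10 \<Omega> = {v \<in> H1 \<Omega>. \<exists>\<phi>::nat \<Rightarrow> 'a \<Rightarrow> real. (\<forall>n. \<phi> n \<in> test_functions \<Omega>) \<and>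
     (\<lambda>n. H1_norm \<Omega> (\<lambda>x. v x - \<phi> n x)) \<longlonglongrightarrow> 0}"

definition weak_partial ::
    "'a::euclidean_space set \<Rightarrow> 'a \<Rightarrow> ('a \<Rightarrow> real) \<Rightarrow> 'a \<Rightarrow> real" where
  "weak_partial \<Omega> b v x = weak_grad \<Omega> v x \<bullet> b"

definition H2 :: "'a::euclidean_space set \<Rightarrow> ('a \<Rightarrow> real) set" where
  "H2 \<Omega> = {v \<in> H1 \<Omega>. \<forall>b\<in>Basis. weak_partial \<Omega> b v \<in> H1 \<Omega>}"

definition H2_norm :: "'a::euclidean_space set \<Rightarrow> ('a \<Rightarrow> real) \<Rightarrow> real" where
  "H2_norm \<Omega> v = sqrt ((L2_norm \<Omega> v)\<^sup>2 + (\<Sum>b\<in>Basis. (L2_norm \<Omega> (weak_partial \<Omega> b v))\<^sup>2) +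
     (\<Sum>b\<in>Basis. \<Sum>c\<in>Basis. (L2_norm \<Omega> (weak_partial \<Omega> c (weak_partial \<Omega> b v)))\<^sup>2))"

definition weak_laplacian :: "'a::euclidean_space set \<Rightarrow> ('a \<Rightarrow> real) \<Rightarrow> 'a \<Rightarrow> real" where
  "weak_laplacian \<Omega> v x = (\<Sum>b\<in>Basis. weak_partial \<Omega> b (weak_partial \<Omega> b v) x)"

section \<open>Functions of time with values in function spaces\<close>

definition L2_continuous_on ::
    "'a::euclidean_space set \<Rightarrow> real set \<Rightarrow> (real \<Rightarrow> 'a \<Rightarrow> real) \<Rightarrow> bool" where
  "L2_continuous_on \<Omega> I v \<longleftrightarrow> (\<forall>t\<in>I. v t \<in> L2 \<Omega>) \<and>
     (\<forall>t\<in>I. ((\<lambda>s. L2_norm \<Omega> (\<lambda>x. v s x - v t x)) \<longlongrightarrow> 0) (at t within I))"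

definition H2_continuous_on ::
    "'a::euclidean_space set \<Rightarrow> real set \<Rightarrow> (real \<Rightarrow> 'a \<Rightarrow> real) \<Rightarrow> bool" where
  "H2_continuous_on \<Omega> I v \<longleftrightarrow> (\<forall>t\<in>I. v t \<in> H2 \<Omega>) \<and>
     (\<forall>t\<in>I. ((\<lambda>s. H2_norm \<Omega> (\<lambda>x. v s x - v t x)) \<longlongrightarrow> 0) (at t within I))"

text \<open>\<open>v'\<close> is the derivative of \<open>v\<close> on \<open>I\<close> in the norm of \<open>L2 \<Omega>\<close> (one-sided at end points).\<close>

definition L2_has_derivative_on ::
    "'a::euclidean_space set \<Rightarrow> real set \<Rightarrow> (real \<Rightarrow> 'a \<Rightarrow> real) \<Rightarrow> (real \<Rightarrow> 'a \<Rightarrow> real) \<Rightarrow> bool" where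
  "L2_has_derivative_on \<Omega> I v v' \<longleftrightarrow> (\<forall>t\<in>I. v t \<in> L2 \<Omega> \<and> v' t \<in> L2 \<Omega>) \<and>
     (\<forall>t\<in>I. ((\<lambda>s. L2_norm \<Omega> (\<lambda>x. (v s x - v t x) / (s - t) - v' t x)) \<longlongrightarrow> 0) (at t within I))"

section \<open>The diffusion problem\<close>

text \<open>\<open>ut\<close>, \<open>utt\<close>, \<open>uttt\<close> are the first three time derivatives of \<open>u\<close>.  The first four conjuncts
  of the definition say that \<open>u\<close> is in \<open>C\<^sup>3([0,T]; L2 \<Omega>)\<close> (differentiability
  gives continuity of the lower derivatives); the boundary condition is membership
  in \<open>H10 \<Omega>\<close>.\<close>

definition diffusion_solution ::
    "'a::euclidean_space set \<Rightarrow> real \<Rightarrow> ('a \<Rightarrow> real) \<Rightarrow> real \<Rightarrow> (real \<Rightarrow> 'a \<Rightarrow> real) \<Rightarrow> ('a \<Rightarrow> real) \<Rightarrow>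
     (real \<Rightarrow> 'a \<Rightarrow> real) \<Rightarrow> (real \<Rightarrow> 'a \<Rightarrow> real) \<Rightarrow> (real \<Rightarrow> 'a \<Rightarrow> real) \<Rightarrow> (real \<Rightarrow> 'a \<Rightarrow> real) \<Rightarrow> bool" where
  "diffusion_solution \<Omega> \<epsilon> \<kappa> T f u0 u ut utt uttt \<longleftrightarrow>
     L2_has_derivative_on \<Omega> {0..T} u ut \<and>
     L2_has_derivative_on \<Omega> {0..T} ut utt \<and>
     L2_has_derivative_on \<Omega> {0..T} utt uttt \<and>
     L2_continuous_on \<Omega> {0..T} uttt \<and>
     H2_continuous_on \<Omega> {0..T} u \<and>
     (\<forall>t\<in>{0..T}. u t \<in> H10 \<Omega>) \<and>
     (AE x in lebesgue_on \<Omega>. u 0 x = u0 x) \<and>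
     (\<forall>t\<in>{0<..T}. AE x in lebesgue_on \<Omega>.
        ut t x - \<epsilon> * weak_laplacian \<Omega> (u t) x = \<kappa> x * u t x + f t x)"

section \<open>The variable-step BDF2 scheme\<close>

definition time_mesh :: "real \<Rightarrow> nat \<Rightarrow> (nat \<Rightarrow> real) \<Rightarrow> bool" where
  "time_mesh T N t \<longleftrightarrow> t 0 = 0 \<and> t N = T \<and> (\<forall>k<N. t k < t (Suc k))"

definition step :: "(nat \<Rightarrow> real) \<Rightarrow> nat \<Rightarrow> real" where
  "step t k = t k - t (k - 1)"

definition ratio :: "(nat \<Rightarrow> real) \<Rightarrow> nat \<Rightarrow> real" where
  "ratio t k = step t k / step t (k - 1)"

text \<open>\<open>bdf2_kernel t n j\<close> is the kernel with upper index \<open>n\<close> and lower index \<open>j\<close>; it is meaningful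
  for \<open>n \<ge> 1\<close> and \<open>j \<le> n - 1\<close>.\<close>

definition bdf2_kernel :: "(nat \<Rightarrow> real) \<Rightarrow> nat \<Rightarrow> nat \<Rightarrow> real" where
  "bdf2_kernel t n j =
    (if n = 1 then (if j = 0 then 1 / step t 1 else 0)
     else if j = 0 then (1 + 2 * ratio t n) / (step t n * (1 + ratio t n))
     else if j = 1 then - ((ratio t n)\<^sup>2 / (step t n * (1 + ratio t n)))
     else 0)"

definition bdf2_kernels_psd :: "nat \<Rightarrow> (nat \<Rightarrow> real) \<Rightarrow> bool" where
  "bdf2_kernels_psd N t \<longleftrightarrow> (\<forall>n\<in>{1..N}. \<forall>w::nat \<Rightarrow> real.
     (\<Sum>k=1..n. w k * (\<Sum>j=1..k. bdf2_kernel t k (k - j) * w j)) \<ge> 0)"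

definition D2 :: "(nat \<Rightarrow> real) \<Rightarrow> (nat \<Rightarrow> 'a \<Rightarrow> real) \<Rightarrow> nat \<Rightarrow> 'a \<Rightarrow> real" where
  "D2 t v n x = (\<Sum>k=1..n. bdf2_kernel t n (n - k) * (v k x - v (k - 1) x))"

text \<open>The values \<open>U 0, \<dots>, U (m - 1)\<close> are given data and the variational equation holds on
  the levels \<open>m, \<dots>, N\<close>: \<open>m = 1\<close> is the scheme with a BDF1 first step, and \<open>m = 2\<close> the one in
  which \<open>U 1\<close> comes from another starting scheme.\<close>

definition adaptive_bdf2 ::
    "nat \<Rightarrow> 'a::euclidean_space set \<Rightarrow> real \<Rightarrow> ('a \<Rightarrow> real) \<Rightarrow> (real \<Rightarrow> 'a \<Rightarrow> real) \<Rightarrow>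
     nat \<Rightarrow> (nat \<Rightarrow> real) \<Rightarrow> (nat \<Rightarrow> 'a \<Rightarrow> real) \<Rightarrow> bool" where
  "adaptive_bdf2 m \<Omega> \<epsilon> \<kappa> f N t U \<longleftrightarrow>
     (\<forall>n<m. U n \<in> L2 \<Omega>) \<and>
     (\<forall>n\<in>{m..N}. U n \<in> H10 \<Omega> \<and>
        (\<forall>w\<in>H10 \<Omega>.
           L2_inner \<Omega> (D2 t U n) w + \<epsilon> * L2_inner \<Omega> (weak_grad \<Omega> (U n)) (weak_grad \<Omega> w) =
           L2_inner \<Omega> (\<lambda>x. \<kappa> x * U n x) w + L2_inner \<Omega> (f (t n)) w))"

end

(* The BDF2 difference is inverted by discrete orthogonal convolution (DOC) kernels, which are
   nonnegative, sum to the step size, and inherit positive semi-definiteness from the BDF2 kernels.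
   Convolving the error equation with them turns D2 e into e^k - e^(k-1); testing with e^k and summing
   over k makes the diffusion term nonnegative, so that
     |e^n|^2 <= |e^(m-1)|^2 + 2 sum_k sum_j theta^(k)_(k-j) <kappa e^j + eta^j, e^k>,
   and a discrete Gronwall argument for the running maximum of |e^k| gives the bound.  In the second
   part the missing equation at level 1 is replaced by the identity D2 e^1 = (e^1 - e^0) / tau_1.
   The truncation error eta^j only enters through <eta^j, w>, so it is estimated for the scalar
   functions s |-> <u(s), w> and no integration of L2-valued functions is needed.
   That the exact solution satisfies the variational equation needs uniqueness of weak gradients,
   hence enough test functions: products of exp(-1/x) bumps approximating indicators of boxes. *)

theory Submission
  imports Defs
begin

section \<open>Smooth bumps and the fundamental lemma\<close>

text \<open>Convolving up to level k requires the error equations of all levels j <= k tested with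
  the same e^k, so the equation is set up for pairs (j, k) and not only for j = k. The error is
  never shown to lie in \<open>H10\<close>: the equation is tested with u(t_k) and U^k separately
  and the results are subtracted, and the difference of the two chosen weak gradients stands for the
  gradient of e^k. The summed inequality is quadratic in the errors. At the level where the running
  maximum is attained one factor can be cancelled, and it becomes linear. Absorbing it doubles
  everything else, which explains the leading factor 2 and the rate 4 kappa* instead of 2 kappa*,
  and leaves a sum that ends one level earlier, hence t_(n-1) in the exponent. A source bounded by G
  enters through the row sums tau_k, whose total is at most t_n, and so contributes 2 t_n G.\<close>

definition bump :: "real poly \<Rightarrow> real \<Rightarrow> real" where
  "bump p x = (if x > 0 then poly p (1 / x) * exp (- (1 / x)) else 0)"

lemma tendsto_poly_times_exp_minus:
  "((\<lambda>y::real. poly p y * exp (- y)) \<longlongrightarrow> 0) at_top"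
proof -
  have "((\<lambda>y::real. \<Sum>i\<le>degree p. coeff p i * (y ^ i / exp y)) \<longlongrightarrow> (\<Sum>i\<le>degree p. coeff p i * 0)) at_top"
    by (intro tendsto_sum tendsto_mult_left tendsto_power_div_exp_0)
  then show ?thesis
    by (simp add: poly_altdef sum_distrib_right exp_minus divide_inverse mult.assoc)
qed

text \<open>With y = 1/x, differentiating p(y) exp(-y) in x gives y^2 (p - p')(y) exp(-y). The
  family is thus closed under differentiation, which is why \<open>bump\<close> carries a
  polynomial.\<close>

lemma bump_has_derivative:
  "(bump p has_real_derivative bump (monom 1 2 * (p - pderiv p)) x) (at x)"
proof -
  consider "x > 0" | "x < 0" | "x = 0" by linarith
  then show ?thesis
  proof cases
    case 1
    have "((\<lambda>x. poly p (1 / x) * exp (- (1 / x))) has_real_derivative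
        bump (monom 1 2 * (p - pderiv p)) x) (at x)"
      using 1
      by (auto intro!: derivative_eq_intros DERIV_chain2[where f="poly p"] poly_DERIV
          simp: bump_def poly_monom power2_eq_square field_simps)
    then show ?thesis
      by (rule has_field_derivative_transform_within_open[where S="{0<..}"])
         (use 1 in \<open>auto simp: bump_def\<close>)
  next
    case 2
    have "((\<lambda>x. 0) has_real_derivative bump (monom 1 2 * (p - pderiv p)) x) (at x)"
      using 2 by (simp add: bump_def)
    then show ?thesis
      by (rule has_field_derivative_transform_within_open[where S="{..<0}"])
         (use 2 in \<open>auto simp: bump_def\<close>)
  next
    case 3
    \<comment> \<open>Dividing by h multiplies by y = 1/h, which \<open>pCons 0\<close> encodes; the
      limit at 0 from the right becomes one at infinity.\<close>
    have "((\<lambda>h. poly (pCons 0 p) (inverse h) * exp (- inverse h)) \<longlongrightarrow> 0) (at_right 0)"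
      by (rule filterlim_compose[OF tendsto_poly_times_exp_minus filterlim_inverse_at_top_right])
    then have "((\<lambda>h. bump p h / h) \<longlongrightarrow> 0) (at_right 0)"
      by (rule Lim_transform_eventually)
         (auto simp: bump_def eventually_at_filter field_simps inverse_eq_divide)
    moreover have "((\<lambda>h. bump p h / h) \<longlongrightarrow> 0) (at_left 0)"
      by (rule Lim_transform_eventually[OF tendsto_const])
         (auto simp: bump_def eventually_at_filter)
    ultimately have "((\<lambda>h. bump p h / h) \<longlongrightarrow> 0) (at 0)"
      by (simp add: filterlim_split_at)
    then show ?thesis using 3 by (simp add: DERIV_def bump_def)
  qed
qed

text \<open>An algebra closed under partial derivatives, so that smoothness follows from differentiability
  of its members.\<close>

inductive_set bump_algebra :: "('a::euclidean_space \<Rightarrow> real) set" where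
  bump: "(\<lambda>x. bump p (c * (x \<bullet> b) + d)) \<in> bump_algebra"
| const: "(\<lambda>x. c) \<in> bump_algebra"
| add: "f \<in> bump_algebra \<Longrightarrow> g \<in> bump_algebra \<Longrightarrow> (\<lambda>x. f x + g x) \<in> bump_algebra"
| mult: "f \<in> bump_algebra \<Longrightarrow> g \<in> bump_algebra \<Longrightarrow> (\<lambda>x. f x * g x) \<in> bump_algebra"

lemma frechet_derivative_eqI:
  "(f has_derivative f') (at x) \<Longrightarrow> frechet_derivative f (at x) = f'"
  by (metis frechet_derivative_at)

text \<open>The direction v is fixed while x varies, because the recursion of \<open>Ck_on\<close>
  asks for smoothness of each partial derivative as a function of the point.\<close>

lemma bump_algebra_derivative:
  assumes "f \<in> bump_algebra"
  shows "\<exists>f'. (\<forall>x. (f has_derivative f' x) (at x)) \<and> (\<forall>v. (\<lambda>x. f' x v) \<in> bump_algebra)"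
  using assms
proof induction
  case (bump p c b d)
  let ?q = "monom 1 2 * (p - pderiv p)"
  have "((\<lambda>x. bump p (c * (x \<bullet> b) + d)) has_derivative
      (\<lambda>v. bump ?q (c * (x \<bullet> b) + d) * (c * (v \<bullet> b)))) (at x)" for x
    by (rule has_derivative_compose[OF _ bump_has_derivative[THEN has_field_derivative_imp_has_derivative], THEN has_derivative_eq_rhs])
       (auto intro!: derivative_eq_intros)
  moreover have "(\<lambda>x. bump ?q (c * (x \<bullet> b) + d) * (c * (v \<bullet> b))) \<in> bump_algebra" for v
    by (intro bump_algebra.intros)
  ultimately show ?case by (intro exI[of _ "\<lambda>x v. bump ?q (c * (x \<bullet> b) + d) * (c * (v \<bullet> b))"]) blast
next
  case (const c)
  show ?case by (rule exI[of _ "\<lambda>_ _. 0"]) (auto intro: bump_algebra.intros)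
next
  case (add f g)
  then obtain f' g' where *: "\<And>x. (f has_derivative f' x) (at x)" "\<And>v. (\<lambda>x. f' x v) \<in> bump_algebra"
    "\<And>x. (g has_derivative g' x) (at x)" "\<And>v. (\<lambda>x. g' x v) \<in> bump_algebra" by blast
  show ?case
    by (rule exI[of _ "\<lambda>x v. f' x v + g' x v"])
       (auto intro!: has_derivative_add bump_algebra.add *)
next
  case (mult f g)
  then obtain f' g' where *: "\<And>x. (f has_derivative f' x) (at x)" "\<And>v. (\<lambda>x. f' x v) \<in> bump_algebra"
    "\<And>x. (g has_derivative g' x) (at x)" "\<And>v. (\<lambda>x. g' x v) \<in> bump_algebra" by blast
  show ?case
    by (rule exI[of _ "\<lambda>x v. f x * g' x v + f' x v * g x"])
       (intro conjI allI has_derivative_mult bump_algebra.add bump_algebra.mult * mult.hyps)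
qed

lemma bump_algebra_smooth: "f \<in> bump_algebra \<Longrightarrow> smooth_on S f"
proof -
  have "Ck_on k S f" if "f \<in> bump_algebra" for k
    using that
  proof (induction k arbitrary: f)
    case 0
    then show ?case
      using bump_algebra_derivative has_derivative_continuous_on[of S f]
      by (metis Ck_on.simps(1) has_derivative_at_withinI)
  next
    case (Suc k)
    obtain f' where f': "\<And>x. (f has_derivative f' x) (at x)" "\<And>v. (\<lambda>x. f' x v) \<in> bump_algebra"
      using bump_algebra_derivative[OF Suc.prems] by blast
    have "frechet_derivative f (at x) = f' x" for x
      using f'(1) by (rule frechet_derivative_eqI)
    then show ?case
      using f' Suc.IH by (auto simp: differentiable_def)
  qed
  then show "f \<in> bump_algebra \<Longrightarrow> smooth_on S f" by (simp add: smooth_on_def)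
qed

text \<open>The factor \<open>Suc n\<close> steepens the edges without moving the support: at
  distance y > 0 inside a face, exp (-1 / ((n + 1) y)) tends to 1. The limit is the indicator of the
  open box, and the common bound 1 allows dominated convergence.\<close>

definition box_bump :: "'a::euclidean_space \<Rightarrow> 'a \<Rightarrow> nat \<Rightarrow> 'a \<Rightarrow> real" where
  "box_bump l u n x = (\<Prod>b\<in>Basis.
     bump 1 (real (Suc n) * (x \<bullet> b - l \<bullet> b)) * bump 1 (real (Suc n) * (u \<bullet> b - x \<bullet> b)))"

lemma box_bump_smooth: "smooth_on S (box_bump l u n)"
proof -
  have "(\<lambda>x. \<Prod>b\<in>F. bump 1 (real (Suc n) * (x \<bullet> b - l \<bullet> b)) * bump 1 (real (Suc n) * (u \<bullet> b - x \<bullet> b)))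
      \<in> bump_algebra" if "finite F" for F :: "'a set"
    using that
  proof induction
    case empty
    show ?case by (simp add: bump_algebra.const)
  next
    case (insert b F)
    have "(\<lambda>x::'a. bump 1 (real (Suc n) * (x \<bullet> b) + - real (Suc n) * (l \<bullet> b))) \<in> bump_algebra"
      "(\<lambda>x::'a. bump 1 (- real (Suc n) * (x \<bullet> b) + real (Suc n) * (u \<bullet> b))) \<in> bump_algebra"
      by (rule bump_algebra.bump)+
    then have "(\<lambda>x::'a. bump 1 (real (Suc n) * (x \<bullet> b - l \<bullet> b))) \<in> bump_algebra"
      "(\<lambda>x::'a. bump 1 (real (Suc n) * (u \<bullet> b - x \<bullet> b))) \<in> bump_algebra"
      by (simp_all add: algebra_simps)
    from bump_algebra.mult[OF bump_algebra.mult[OF this] insert.IH] insert.hyps show ?case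
      by simp
  qed
  from this[OF finite_Basis] have "box_bump l u n \<in> bump_algebra"
    unfolding box_bump_def[abs_def] .
  then show ?thesis by (rule bump_algebra_smooth)
qed

lemma bump_one_bounds: "0 \<le> bump 1 x" "bump 1 x \<le> 1" "x \<le> 0 \<Longrightarrow> bump 1 x = 0"
  by (auto simp: bump_def)

lemma box_bump_bounds: "0 \<le> box_bump l u n x" "box_bump l u n x \<le> 1"
  unfolding box_bump_def
  by (auto intro!: prod_nonneg prod_le_1 mult_le_one mult_nonneg_nonneg bump_one_bounds)

lemma box_bump_outside: "x \<notin> box l u \<Longrightarrow> box_bump l u n x = 0"
  by (auto simp: box_bump_def mem_box bump_def zero_less_mult_iff prod_zero_iff)

lemma bump_one_scaled_tendsto:
  assumes "y > 0"
  shows "(\<lambda>n. bump 1 (real (Suc n) * y)) \<longlonglongrightarrow> 1"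
proof -
  have "(\<lambda>n. exp (- (inverse (real (Suc n)) * (1 / y)))) \<longlonglongrightarrow> exp (- (0 * (1 / y)))"
    by (intro tendsto_intros LIMSEQ_inverse_real_of_nat)
  moreover have "bump 1 (real (Suc n) * y) = exp (- (inverse (real (Suc n)) * (1 / y)))" for n
    using assms by (simp add: bump_def zero_less_mult_iff inverse_eq_divide del: of_nat_Suc)
  ultimately show ?thesis by (simp del: of_nat_Suc)
qed

lemma box_bump_tendsto: "(\<lambda>n. box_bump l u n x) \<longlonglongrightarrow> indicator (box l u) x"
proof (cases "x \<in> box l u")
  case True
  then have "(\<lambda>n. box_bump l u n x) \<longlonglongrightarrow> (\<Prod>b\<in>(Basis::'a set). 1 * 1)"
    unfolding box_bump_def
    by (intro tendsto_prod tendsto_mult bump_one_scaled_tendsto) (auto simp: mem_box)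
  with True show ?thesis by simp
qed (simp add: box_bump_outside)

lemma box_bump_test_function:
  assumes "cbox l u \<subseteq> \<Omega>"
  shows "box_bump l u n \<in> test_functions \<Omega>"
proof -
  have "{x. box_bump l u n x \<noteq> 0} \<subseteq> cbox l u"
    using box_bump_outside[of _ l u n] box_subset_cbox[of l u] by blast
  then have "closure {x. box_bump l u n x \<noteq> 0} \<subseteq> cbox l u"
    by (rule closure_minimal) (rule closed_cbox)
  with assms show ?thesis
    by (auto simp: test_functions_def box_bump_smooth bounded_subset[OF bounded_cbox] compact_eq_bounded_closed)
qed

text \<open>Dominated convergence along the box bumps shows that the integral of \<open>g\<close> over every small box
  vanishes; Lebesgue differentiation over cubes concludes.\<close>

lemma fundamental_lemma_test_functions:
  fixes g :: "'a::euclidean_space \<Rightarrow> real"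
  assumes "open \<Omega>" and g: "integrable (lebesgue_on \<Omega>) g"
    and zero: "\<And>\<phi>. \<phi> \<in> test_functions \<Omega> \<Longrightarrow> (LINT x|lebesgue_on \<Omega>. g x * \<phi> x) = 0"
  shows "AE x in lebesgue_on \<Omega>. g x = 0"
proof -
  define f where "f x = (if x \<in> \<Omega> then g x else 0)" for x
  have \<Omega>: "\<Omega> \<in> sets lebesgue" using \<open>open \<Omega>\<close> by auto
  have f: "integrable lebesgue f"
  proof -
    have "f = (\<lambda>x. indicator \<Omega> x *\<^sub>R g x)" by (auto simp: f_def)
    with g \<Omega> show ?thesis by (simp add: integrable_restrict_space)
  qed
  then have fi: "f integrable_on UNIV"
    by (metis integrable_on_lebesgue)
  have fc: "f integrable_on cbox a b" for a b
    using fi integrable_on_subcbox by blast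
  have box0: "integral (cbox l u) f = 0" if sub: "cbox l u \<subseteq> \<Omega>" for l u
  proof -
    have "(\<lambda>n. LINT x|lebesgue_on \<Omega>. g x * box_bump l u n x) \<longlonglongrightarrow>
        (LINT x|lebesgue_on \<Omega>. g x * indicator (box l u) x)"
    proof (rule integral_dominated_convergence[where w="\<lambda>x. norm (g x)"])
      show "AE x in lebesgue_on \<Omega>. (\<lambda>n. g x * box_bump l u n x) \<longlonglongrightarrow> g x * indicator (box l u) x"
        by (intro AE_I2 tendsto_mult_left box_bump_tendsto)
      show "AE x in lebesgue_on \<Omega>. norm (g x * box_bump l u n x) \<le> norm (g x)" for n
        using box_bump_bounds[of l u n] by (auto simp: abs_mult intro!: mult_left_le)
      have [measurable]: "g \<in> borel_measurable (lebesgue_on \<Omega>)" using g by auto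
      have "continuous_on UNIV (box_bump l u n)" for n
        using box_bump_smooth[of UNIV l u n] unfolding smooth_on_def by (metis Ck_on.simps(1))
      then have [measurable]: "box_bump l u n \<in> borel_measurable (lebesgue_on \<Omega>)" for n
        using \<Omega> by (meson continuous_imp_measurable_on_sets_lebesgue continuous_on_subset subset_UNIV)
      show "(\<lambda>x. g x * box_bump l u n x) \<in> borel_measurable (lebesgue_on \<Omega>)" for n by measurable
      have "(indicator (box l u) :: 'a \<Rightarrow> real) \<in> borel_measurable (lebesgue_on \<Omega>)"
        by (intro measurable_restrict_space1 measurable_completion) auto
      then show "(\<lambda>x. g x * indicator (box l u) x) \<in> borel_measurable (lebesgue_on \<Omega>)" by measurable
    qed (use g in auto)
    then have "(LINT x|lebesgue_on \<Omega>. g x * indicator (box l u) x) = 0"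
      using zero[OF box_bump_test_function[OF sub]] by (simp add: LIMSEQ_const_iff)
    moreover have "(LINT x|lebesgue_on \<Omega>. g x * indicator (box l u) x) = (LINT x|lebesgue. indicator (box l u) x *\<^sub>R f x)"
      using \<Omega> by (auto simp: integral_restrict_space set_lebesgue_integral_def f_def indicator_def intro!: Bochner_Integration.integral_cong)
    moreover have "set_integrable lebesgue (box l u) f"
      unfolding set_integrable_def by (rule integrable_mult_indicator[OF _ f]) auto
    ultimately have "integral (box l u) f = 0"
      using set_lebesgue_integral_eq_integral(2)[of "box l u" f] by (simp add: set_lebesgue_integral_def)
    then show ?thesis by (simp add: integral_open_interval)
  qed
  obtain Z where Z: "negligible Z"
    and diff: "\<And>x e. x \<notin> Z \<Longrightarrow> 0 < e \<Longrightarrow> \<exists>d>0. \<forall>h. 0 < h \<and> h < d \<longrightarrow>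
       norm (integral (cbox x (x + h *\<^sub>R One)) f /\<^sub>R h ^ DIM('a) - f x) < e"
    using integrable_ccontinuous_explicit[OF fc] by blast
  have "f x = 0" if x: "x \<in> \<Omega>" "x \<notin> Z" for x
  proof (rule ccontr)
    assume "f x \<noteq> 0"
    then obtain d where d: "d > 0" "\<And>h. 0 < h \<Longrightarrow> h < d \<Longrightarrow>
       norm (integral (cbox x (x + h *\<^sub>R One)) f /\<^sub>R h ^ DIM('a) - f x) < norm (f x)"
      using diff[OF x(2), of "norm (f x)"] by auto
    obtain r where r: "r > 0" "cball x r \<subseteq> \<Omega>"
      using \<open>open \<Omega>\<close> \<open>x \<in> \<Omega>\<close> open_contains_cball by blast
    \<comment> \<open>The cube of side h has diagonal h times \<open>norm One\<close>; this choice
      keeps it inside the ball of radius r and h below d.\<close>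
    define h where "h = min (d / 2) (r / norm (One::'a))"
    have One: "norm (One::'a) > 0" by auto
    have h: "0 < h" "h < d" "h * norm (One::'a) \<le> r"
      using d(1) r(1) One by (auto simp: h_def min_def field_simps)
    have "cbox x (x + h *\<^sub>R One) \<subseteq> cball x r"
    proof
      fix y assume y: "y \<in> cbox x (x + h *\<^sub>R One)"
      have "norm (y - x) \<le> norm (h *\<^sub>R (One::'a))"
        using y by (intro norm_le_componentwise) (auto simp: mem_box inner_diff_left inner_add_left)
      with h show "y \<in> cball x r" by (simp add: dist_norm norm_minus_commute)
    qed
    then have "integral (cbox x (x + h *\<^sub>R One)) f = 0" using r(2) box0 by blast
    with d(2)[OF h(1,2)] show False by simp
  qed
  then have "AE x in lebesgue. x \<in> \<Omega> \<longrightarrow> g x = 0"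
    using Z by (auto simp: f_def negligible_iff_null_sets eventually_ae_filter intro!: exI[of _ Z]) 
  then show ?thesis using \<Omega> by (simp add: AE_restrict_space_iff)
qed

section \<open>The space \<open>L2\<close>\<close>

lemma L2_integrable_inner:
  assumes "v \<in> L2 \<Omega>" "w \<in> L2 \<Omega>"
  shows "integrable (lebesgue_on \<Omega>) (\<lambda>x. v x \<bullet> w x)"
proof (rule Bochner_Integration.integrable_bound)
  show "integrable (lebesgue_on \<Omega>) (\<lambda>x. (norm (v x))\<^sup>2 + (norm (w x))\<^sup>2)"
    using assms by (auto simp: L2_def)
  show "(\<lambda>x. v x \<bullet> w x) \<in> borel_measurable (lebesgue_on \<Omega>)"
    using assms by (auto simp: L2_def)
  have "\<bar>a \<bullet> b\<bar> \<le> (norm a)\<^sup>2 + (norm b)\<^sup>2" for a b :: 'b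
    using Cauchy_Schwarz_ineq2[of a b] sum_squares_bound[of "norm a" "norm b"]
      mult_nonneg_nonneg[OF norm_ge_zero[of a] norm_ge_zero[of b]] by linarith
  then show "AE x in lebesgue_on \<Omega>. norm (v x \<bullet> w x) \<le> norm ((norm (v x))\<^sup>2 + (norm (w x))\<^sup>2)"
    by auto
qed

lemma L2_add: "v \<in> L2 \<Omega> \<Longrightarrow> w \<in> L2 \<Omega> \<Longrightarrow> (\<lambda>x. v x + w x) \<in> L2 \<Omega>"
proof -
  assume v: "v \<in> L2 \<Omega>" and w: "w \<in> L2 \<Omega>"
  have "(norm (v x + w x))\<^sup>2 = (norm (v x))\<^sup>2 + 2 * (v x \<bullet> w x) + (norm (w x))\<^sup>2" for x
    by (simp add: power2_norm_eq_inner inner_add_left inner_add_right inner_commute)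
  moreover have "integrable (lebesgue_on \<Omega>) (\<lambda>x. (norm (v x))\<^sup>2 + 2 * (v x \<bullet> w x) + (norm (w x))\<^sup>2)"
    using v w L2_integrable_inner[OF v w] by (intro Bochner_Integration.integrable_add) (auto simp: L2_def)
  ultimately show ?thesis
    using v w by (auto simp: L2_def)
qed

lemma L2_scale: "v \<in> L2 \<Omega> \<Longrightarrow> (\<lambda>x. c *\<^sub>R v x) \<in> L2 \<Omega>"
  by (auto simp: L2_def power_mult_distrib)

lemma L2_cmult: "v \<in> L2 \<Omega> \<Longrightarrow> (\<lambda>x. c * v x :: real) \<in> L2 \<Omega>"
  using L2_scale[of v \<Omega> c] by simp

lemma L2_diff: "v \<in> L2 \<Omega> \<Longrightarrow> w \<in> L2 \<Omega> \<Longrightarrow> (\<lambda>x. v x - w x) \<in> L2 \<Omega>"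
  using L2_add[OF _ L2_scale[of w \<Omega> "-1"], of v] by simp

lemma L2_zero: "(\<lambda>x. 0) \<in> L2 \<Omega>"
  by (simp add: L2_def)

lemma L2_sum: "(\<And>i. i \<in> I \<Longrightarrow> v i \<in> L2 \<Omega>) \<Longrightarrow> (\<lambda>x. \<Sum>i\<in>I. v i x) \<in> L2 \<Omega>"
  by (induction I rule: infinite_finite_induct) (auto intro: L2_zero L2_add)

lemma L2_component: "v \<in> L2 \<Omega> \<Longrightarrow> (\<lambda>x. v x \<bullet> b) \<in> L2 \<Omega>"
proof -
  assume v: "v \<in> L2 \<Omega>"
  have "integrable (lebesgue_on \<Omega>) (\<lambda>x. (v x \<bullet> b)\<^sup>2)"
  proof (rule Bochner_Integration.integrable_bound)
    show "integrable (lebesgue_on \<Omega>) (\<lambda>x. (norm (v x))\<^sup>2 * (norm b)\<^sup>2)"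
      using v by (auto simp: L2_def)
    show "(\<lambda>x. (v x \<bullet> b)\<^sup>2) \<in> borel_measurable (lebesgue_on \<Omega>)"
      using v by (auto simp: L2_def)
    have "\<bar>(v x \<bullet> b)\<^sup>2\<bar> \<le> \<bar>(norm (v x))\<^sup>2 * (norm b)\<^sup>2\<bar>" for x
      using Cauchy_Schwarz_ineq[of "v x" b] by (simp add: power2_norm_eq_inner)
    then show "AE x in lebesgue_on \<Omega>. norm ((v x \<bullet> b)\<^sup>2) \<le> norm ((norm (v x))\<^sup>2 * (norm b)\<^sup>2)"
      by auto
  qed
  with v show ?thesis by (auto simp: L2_def)
qed

lemma L2_bounded_mult:
  fixes k v :: "'a::euclidean_space \<Rightarrow> real"
  assumes "v \<in> L2 \<Omega>" "k \<in> borel_measurable (lebesgue_on \<Omega>)" "\<forall>x\<in>\<Omega>. \<bar>k x\<bar> \<le> C"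
  shows "(\<lambda>x. k x * v x) \<in> L2 \<Omega>"
proof -
  have "integrable (lebesgue_on \<Omega>) (\<lambda>x. (k x * v x)\<^sup>2)"
  proof (rule Bochner_Integration.integrable_bound)
    show "integrable (lebesgue_on \<Omega>) (\<lambda>x. C\<^sup>2 * (v x)\<^sup>2)"
      using assms by (auto simp: L2_def)
    show "(\<lambda>x. (k x * v x)\<^sup>2) \<in> borel_measurable (lebesgue_on \<Omega>)"
      using assms by (auto simp: L2_def)
    have "(k x * v x)\<^sup>2 \<le> C\<^sup>2 * (v x)\<^sup>2" if "x \<in> \<Omega>" for x
      using assms(3) that by (auto simp: power_mult_distrib intro!: mult_right_mono abs_le_square_iff[THEN iffD1]
          order_trans[OF _ abs_ge_self])
    then show "AE x in lebesgue_on \<Omega>. norm ((k x * v x)\<^sup>2) \<le> norm (C\<^sup>2 * (v x)\<^sup>2)"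
      by auto
  qed
  with assms show ?thesis by (auto simp: L2_def)
qed

text \<open>Continuity on the whole space gives a bound on the compact closure of
  \<open>\<Omega>\<close>, and \<open>\<Omega>\<close> has finite measure. The lemma serves test
  functions, their gradients and the constant 1.\<close>

lemma L2_continuous:
  fixes f :: "'a::euclidean_space \<Rightarrow> 'b::euclidean_space"
  assumes "open \<Omega>" "bounded \<Omega>" "continuous_on UNIV f"
  shows "f \<in> L2 \<Omega>"
proof -
  have \<Omega>: "\<Omega> \<in> lmeasurable" "\<Omega> \<in> sets lebesgue"
    using assms by (auto intro: bounded_set_imp_lmeasurable)
  interpret finite_measure "lebesgue_on \<Omega>"
    using \<Omega> by (rule_tac finite_measure_lebesgue_on)
  have m: "f \<in> borel_measurable (lebesgue_on \<Omega>)"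
    using \<Omega> assms(3) by (meson continuous_imp_measurable_on_sets_lebesgue continuous_on_subset subset_UNIV)
  have "compact (f ` closure \<Omega>)"
    using assms by (intro compact_continuous_image) (auto simp: compact_eq_bounded_closed intro: continuous_on_subset)
  then have "bounded (f ` closure \<Omega>)" by (rule compact_imp_bounded)
  then obtain B where "\<forall>y\<in>f ` closure \<Omega>. norm y \<le> B" by (auto simp: bounded_iff)
  then have B: "norm (f x) \<le> B" if "x \<in> \<Omega>" for x
    using that closure_subset[of \<Omega>] by blast
  have "integrable (lebesgue_on \<Omega>) (\<lambda>x. (norm (f x))\<^sup>2)"
    using B m by (intro integrable_const_bound[where B="B\<^sup>2"]) (auto intro!: power_mono)
  with m show ?thesis by (simp add: L2_def)
qed

section \<open>Inner product and seminorm on \<open>L2\<close>\<close>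

lemma L2_inner_commute: "L2_inner \<Omega> v w = L2_inner \<Omega> w v"
  by (simp add: L2_inner_def inner_commute)

lemma L2_inner_add_left:
  "v \<in> L2 \<Omega> \<Longrightarrow> w \<in> L2 \<Omega> \<Longrightarrow> z \<in> L2 \<Omega> \<Longrightarrow>
   L2_inner \<Omega> (\<lambda>x. v x + w x) z = L2_inner \<Omega> v z + L2_inner \<Omega> w z"
  by (simp add: L2_inner_def inner_add_left L2_integrable_inner)

lemma L2_inner_add_right:
  "v \<in> L2 \<Omega> \<Longrightarrow> w \<in> L2 \<Omega> \<Longrightarrow> z \<in> L2 \<Omega> \<Longrightarrow>
   L2_inner \<Omega> z (\<lambda>x. v x + w x) = L2_inner \<Omega> z v + L2_inner \<Omega> z w"
  by (simp add: L2_inner_def inner_add_right L2_integrable_inner)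

lemma L2_inner_diff_left:
  "v \<in> L2 \<Omega> \<Longrightarrow> w \<in> L2 \<Omega> \<Longrightarrow> z \<in> L2 \<Omega> \<Longrightarrow>
   L2_inner \<Omega> (\<lambda>x. v x - w x) z = L2_inner \<Omega> v z - L2_inner \<Omega> w z"
  by (simp add: L2_inner_def inner_diff_left L2_integrable_inner)

lemma L2_inner_diff_right:
  "v \<in> L2 \<Omega> \<Longrightarrow> w \<in> L2 \<Omega> \<Longrightarrow> z \<in> L2 \<Omega> \<Longrightarrow>
   L2_inner \<Omega> z (\<lambda>x. v x - w x) = L2_inner \<Omega> z v - L2_inner \<Omega> z w"
  by (simp add: L2_inner_def inner_diff_right L2_integrable_inner)

lemma L2_inner_cmult_left: "L2_inner \<Omega> (\<lambda>x. c * v x :: real) z = c * L2_inner \<Omega> v z"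
  by (simp add: L2_inner_def mult.assoc)

lemma L2_inner_scale_left: "L2_inner \<Omega> (\<lambda>x. c *\<^sub>R v x) z = c * L2_inner \<Omega> v z"
  by (simp add: L2_inner_def)

lemma L2_inner_scale_right: "L2_inner \<Omega> v (\<lambda>x. c *\<^sub>R z x) = c * L2_inner \<Omega> v z"
  by (simp add: L2_inner_def)

lemma L2_inner_sum_left:
  "(\<And>i. i \<in> I \<Longrightarrow> v i \<in> L2 \<Omega>) \<Longrightarrow> z \<in> L2 \<Omega> \<Longrightarrow>
   L2_inner \<Omega> (\<lambda>x. \<Sum>i\<in>I. v i x) z = (\<Sum>i\<in>I. L2_inner \<Omega> (v i) z)"
  by (simp add: L2_inner_def inner_sum_left L2_integrable_inner)

lemma L2_inner_cong_AE:
  assumes "v \<in> L2 \<Omega>" "v' \<in> L2 \<Omega>" "w \<in> L2 \<Omega>" "AE x in lebesgue_on \<Omega>. v x = v' x"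
  shows "L2_inner \<Omega> v w = L2_inner \<Omega> v' w"
  unfolding L2_inner_def using assms
  by (intro integral_cong_AE) (auto intro!: borel_measurable_integrable L2_integrable_inner)

lemma L2_inner_self_nonneg: "0 \<le> L2_inner \<Omega> v v"
  by (simp add: L2_inner_def)

lemma L2_norm_nonneg: "0 \<le> L2_norm \<Omega> v"
  by (simp add: L2_norm_def L2_inner_self_nonneg)

lemma L2_norm_power2: "(L2_norm \<Omega> v)\<^sup>2 = L2_inner \<Omega> v v"
  by (simp add: L2_norm_def L2_inner_self_nonneg)

lemma L2_norm_cong_AE:
  assumes "v \<in> L2 \<Omega>" "v' \<in> L2 \<Omega>" "AE x in lebesgue_on \<Omega>. v x = v' x"
  shows "L2_norm \<Omega> v = L2_norm \<Omega> v'"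
  unfolding L2_norm_def
  using L2_inner_cong_AE[OF assms(1,2,1,3)] L2_inner_cong_AE[OF assms(1,2,2,3)] L2_inner_commute[of \<Omega> v v']
  by simp

text \<open>Cauchy-Schwarz, from the nonnegativity of s |-> |v - s w|^2. Elements of
  \<open>L2\<close> are functions, so <w, w> = 0 does not force w = 0 and is a case of its own: the
  quadratic is then affine in s, and nonnegative everywhere only if its slope vanishes.\<close>

lemma L2_inner_le_norm:
  assumes v: "v \<in> L2 \<Omega>" and w: "w \<in> L2 \<Omega>"
  shows "\<bar>L2_inner \<Omega> v w\<bar> \<le> L2_norm \<Omega> v * L2_norm \<Omega> w"
proof -
  have quad: "0 \<le> L2_inner \<Omega> v v - 2 * s * L2_inner \<Omega> v w + s\<^sup>2 * L2_inner \<Omega> w w" for s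
  proof -
    have "0 \<le> L2_inner \<Omega> (\<lambda>x. v x - s *\<^sub>R w x) (\<lambda>x. v x - s *\<^sub>R w x)" by (rule L2_inner_self_nonneg)
    also have "\<dots> = (L2_inner \<Omega> v v - s * L2_inner \<Omega> v w) - s * (L2_inner \<Omega> w v - s * L2_inner \<Omega> w w)"
      using v w by (simp add: L2_inner_diff_left L2_inner_diff_right L2_inner_scale_left L2_inner_scale_right L2_diff L2_scale)
    finally show ?thesis by (simp add: L2_inner_commute[of \<Omega> w v] algebra_simps power2_eq_square)
  qed
  have "(L2_inner \<Omega> v w)\<^sup>2 \<le> L2_inner \<Omega> v v * L2_inner \<Omega> w w"
  proof (cases "L2_inner \<Omega> w w = 0")
    case True
    have "L2_inner \<Omega> v w = 0"
    proof (rule ccontr)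
      assume nz: "L2_inner \<Omega> v w \<noteq> 0"
      \<comment> \<open>At this s the affine function takes the value -1.\<close>
      have "2 * ((L2_inner \<Omega> v v + 1) / (2 * L2_inner \<Omega> v w)) * L2_inner \<Omega> v w = L2_inner \<Omega> v v + 1"
        using nz by simp
      with quad[of "(L2_inner \<Omega> v v + 1) / (2 * L2_inner \<Omega> v w)"] True show False by simp
    qed
    with True show ?thesis by simp
  next
    case False
    with L2_inner_self_nonneg[of \<Omega> w] have pos: "L2_inner \<Omega> w w > 0" by simp
    \<comment> \<open>The minimiser s = <v, w> / <w, w> gives the sharpest inequality.\<close>
    from mult_right_mono[OF quad[of "L2_inner \<Omega> v w / L2_inner \<Omega> w w"] less_imp_le[OF pos]] pos
    show ?thesis by (simp add: field_simps power2_eq_square)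
  qed
  then have "(L2_inner \<Omega> v w)\<^sup>2 \<le> (L2_norm \<Omega> v * L2_norm \<Omega> w)\<^sup>2"
    by (simp add: power_mult_distrib L2_norm_power2)
  then show ?thesis
    by (metis L2_norm_nonneg abs_le_square_iff abs_of_nonneg mult_nonneg_nonneg)
qed

lemma L2_norm_triangle:
  assumes v: "v \<in> L2 \<Omega>" and w: "w \<in> L2 \<Omega>"
  shows "L2_norm \<Omega> (\<lambda>x. v x + w x) \<le> L2_norm \<Omega> v + L2_norm \<Omega> w"
proof (rule power2_le_imp_le)
  have "(L2_norm \<Omega> (\<lambda>x. v x + w x))\<^sup>2 = L2_inner \<Omega> v v + 2 * L2_inner \<Omega> v w + L2_inner \<Omega> w w"
    using v w L2_inner_commute[of \<Omega> w v]
    by (simp add: L2_norm_power2 L2_inner_add_left L2_inner_add_right L2_add)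
  also have "\<dots> \<le> (L2_norm \<Omega> v + L2_norm \<Omega> w)\<^sup>2"
    using L2_inner_le_norm[OF v w] by (simp add: power2_sum L2_norm_power2)
  finally show "(L2_norm \<Omega> (\<lambda>x. v x + w x))\<^sup>2 \<le> (L2_norm \<Omega> v + L2_norm \<Omega> w)\<^sup>2" .
qed (simp add: L2_norm_nonneg)

lemma L2_norm_scale: "L2_norm \<Omega> (\<lambda>x. c *\<^sub>R v x) = \<bar>c\<bar> * L2_norm \<Omega> v"
  by (simp add: L2_norm_def L2_inner_def real_sqrt_mult power2_eq_square[symmetric] mult.assoc[symmetric])

lemma L2_norm_minus_commute: "L2_norm \<Omega> (\<lambda>x. v x - w x) = L2_norm \<Omega> (\<lambda>x. w x - v x)"
  using L2_norm_scale[of \<Omega> "-1" "\<lambda>x. v x - w x"] by simp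

lemma L2_norm_triangle_diff:
  assumes v: "v \<in> L2 \<Omega>" and w: "w \<in> L2 \<Omega>"
  shows "\<bar>L2_norm \<Omega> v - L2_norm \<Omega> w\<bar> \<le> L2_norm \<Omega> (\<lambda>x. v x - w x)"
  using L2_norm_triangle[OF L2_diff[OF v w] w] L2_norm_triangle[OF L2_diff[OF w v] v]
    L2_norm_minus_commute[of \<Omega> v w] by simp

lemma L2_integrable:
  fixes v :: "'a::euclidean_space \<Rightarrow> real"
  assumes "open \<Omega>" "bounded \<Omega>" "v \<in> L2 \<Omega>"
  shows "integrable (lebesgue_on \<Omega>) v"
  using L2_integrable_inner[OF assms(3) L2_continuous[OF assms(1,2) continuous_on_const[of _ 1]]] by simp

section \<open>Weak gradients and Green's formula\<close>

text \<open>The difference quotients of \<open>F\<close> integrate to zero by translation invariance.\<close>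

lemma integral_directional_derivative_eq_0:
  fixes F :: "'a::euclidean_space \<Rightarrow> real"
  assumes F': "\<And>x. (F has_derivative F' x) (at x)" and cont: "continuous_on UNIV (\<lambda>x. F' x b)"
    and K: "compact K" "\<And>x. x \<notin> K \<Longrightarrow> F x = 0"
  shows "(LINT x|lborel. F' x b) = 0"
proof -
  have contF: "continuous_on UNIV F"
    by (rule has_derivative_continuous_on[of UNIV F F']) (simp add: F')
  then have [measurable]: "F \<in> borel_measurable borel" by (rule borel_measurable_continuous_onI)
  have "integrable lborel (\<lambda>x. indicator K x *\<^sub>R F x)"
    using K(1) contF by (intro borel_integrable_compact) (auto intro: continuous_on_subset)
  moreover have "(\<lambda>x. indicator K x *\<^sub>R F x) = F" using K(2) by (fastforce simp: indicator_def)
  ultimately have intF: "integrable lborel F" by simp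
  have shift: "integrable lborel (\<lambda>x. F (c + x))" "(LINT x|lborel. F (c + x)) = (LINT x|lborel. F x)" for c
  proof -
    have "integrable (distr lborel borel ((+) c)) F" using intF by (simp add: lborel_distr_plus)
    then show "integrable lborel (\<lambda>x. F (c + x))" by (subst (asm) integrable_distr_eq) auto
    have "(LINT x|lborel. F x) = (LINT x|distr lborel borel ((+) c). F x)" by (simp add: lborel_distr_plus)
    also have "\<dots> = (LINT x|lborel. F (c + x))" by (subst integral_distr) auto
    finally show "(LINT x|lborel. F (c + x)) = (LINT x|lborel. F x)" by simp
  qed
  have F'0: "F' x b = 0" if "x \<notin> K" for x
  proof -
    have "(F has_derivative (\<lambda>_. 0)) (at x)"
      by (rule has_derivative_transform_within_open[where s="- K", OF has_derivative_const[of 0]])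
         (use K that compact_imp_closed in auto)
    then show ?thesis using F'[of x] has_derivative_unique by metis
  qed
  obtain C where C: "\<And>x. \<bar>F' x b\<bar> \<le> C" "C \<ge> 0"
  proof -
    have "bounded ((\<lambda>x. F' x b) ` K)"
      using K(1) cont by (intro compact_imp_bounded compact_continuous_image) (auto intro: continuous_on_subset)
    then obtain B where "\<forall>x\<in>K. \<bar>F' x b\<bar> \<le> B" by (auto simp: bounded_iff)
    then have "\<bar>F' x b\<bar> \<le> max B 0" for x using F'0[of x] by (cases "x \<in> K") auto
    then show ?thesis using that[of "max B 0"] by auto
  qed
  obtain R where R: "K \<subseteq> cball 0 R" using bounded_subset_ballD[OF compact_imp_bounded[OF K(1)], of 0] ball_subset_cball by (meson order_trans)
  have line: "((\<lambda>s. F (s *\<^sub>R b + x)) has_real_derivative F' (s *\<^sub>R b + x) b) (at s)" for x s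
  proof -
    have "((\<lambda>s. F (s *\<^sub>R b + x)) has_derivative (\<lambda>h. F' (s *\<^sub>R b + x) (h *\<^sub>R b))) (at s)"
      by (rule has_derivative_compose[OF _ F', of "\<lambda>s. s *\<^sub>R b + x" "\<lambda>h. h *\<^sub>R b" s UNIV])
         (auto intro!: derivative_eq_intros)
    moreover have "F' y (h *\<^sub>R b) = F' y b * h" for y h
      using F'[of y] by (simp add: has_derivative_linear linear_scale)
    ultimately show ?thesis by (simp add: has_field_derivative_def mult.commute mult_commute_abs)
  qed
  define h where "h n = inverse (real (Suc n))" for n
  have h: "0 < h n" "h n \<le> 1" "h \<longlonglongrightarrow> 0" for n
    using LIMSEQ_inverse_real_of_nat by (auto simp: h_def[abs_def] inverse_eq_divide)
  define q where "q n x = (F (h n *\<^sub>R b + x) - F x) / h n" for n x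
  have "(\<lambda>n. LINT x|lborel. q n x) \<longlonglongrightarrow> (LINT x|lborel. F' x b)"
  \<comment> \<open>By the mean value theorem a difference quotient is a value of the derivative,
    hence at most C in absolute value. Since h n <= 1, all quotients vanish outside the ball of
    radius R + \<open>norm b\<close>, so one integrable function dominates them.\<close>
  proof (rule integral_dominated_convergence[where w="\<lambda>x. indicator (cball 0 (R + norm b)) x *\<^sub>R C"])
    show "integrable lborel (\<lambda>x::'a. indicator (cball 0 (R + norm b)) x *\<^sub>R C)"
      by (intro borel_integrable_compact) auto
    show "(\<lambda>x. F' x b) \<in> borel_measurable lborel" using borel_measurable_continuous_onI[OF cont] by simp
    show "q n \<in> borel_measurable lborel" for n unfolding q_def by measurable
    show "AE x in lborel. (\<lambda>n. q n x) \<longlonglongrightarrow> F' x b"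
    proof (rule AE_I2)
      fix x
      have "((\<lambda>s. (F (s *\<^sub>R b + x) - F x) / s) \<longlongrightarrow> F' x b) (at 0)"
        using line[of x 0] by (simp add: DERIV_def)
      moreover have "filterlim h (at 0) sequentially"
        using h less_imp_neq[OF h(1)] by (auto simp: filterlim_at)
      ultimately show "(\<lambda>n. q n x) \<longlonglongrightarrow> F' x b"
        unfolding q_def by (rule filterlim_compose)
    qed
    show "AE x in lborel. norm (q n x) \<le> indicator (cball 0 (R + norm b)) x *\<^sub>R C" for n
    proof (rule AE_I2)
      fix x
      show "norm (q n x) \<le> indicator (cball 0 (R + norm b)) x *\<^sub>R C"
      proof (cases "x \<in> cball 0 (R + norm b)")
        case True
        obtain z where "F (h n *\<^sub>R b + x) - F (0 *\<^sub>R b + x) = (h n - 0) * F' (z *\<^sub>R b + x) b"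
          using MVT2[of 0 "h n" "\<lambda>s. F (s *\<^sub>R b + x)" "\<lambda>s. F' (s *\<^sub>R b + x) b"] h(1)[of n] line by blast
        then have "q n x = F' (z *\<^sub>R b + x) b" using h(1)[of n] by (simp add: q_def)
        with C True show ?thesis by simp
      next
        case False
        have "norm (h n *\<^sub>R b) \<le> norm b" using h(1,2)[of n] by (auto intro!: mult_left_le_one_le)
        then have "h n *\<^sub>R b + x \<notin> cball 0 R"
          using False norm_triangle_ineq4[of "h n *\<^sub>R b + x" "h n *\<^sub>R b"] by auto
        moreover have "x \<notin> cball 0 R" using False norm_ge_zero[of b] unfolding mem_cball_0 by linarith
        ultimately have "q n x = 0" using K(2) R unfolding q_def by (metis diff_self div_0 subsetD)
        with C(2) show ?thesis by simp
      qed
    qed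
  qed
  moreover have "(LINT x|lborel. q n x) = 0" for n
    using shift[of "h n *\<^sub>R b"] intF by (simp add: q_def)
  ultimately show ?thesis by (simp add: LIMSEQ_const_iff)
qed

lemma test_function_derivative:
  assumes "\<phi> \<in> test_functions \<Omega>"
  shows "(\<phi> has_derivative frechet_derivative \<phi> (at x)) (at x)"
    and "b \<in> Basis \<Longrightarrow> continuous_on UNIV (\<lambda>x. frechet_derivative \<phi> (at x) b)"
    and "b \<in> Basis \<Longrightarrow> grad \<phi> x \<bullet> b = frechet_derivative \<phi> (at x) b"
proof -
  have "Ck_on 1 UNIV \<phi>" using assms by (auto simp: test_functions_def smooth_on_def)
  then show "(\<phi> has_derivative frechet_derivative \<phi> (at x)) (at x)"
    "b \<in> Basis \<Longrightarrow> continuous_on UNIV (\<lambda>x. frechet_derivative \<phi> (at x) b)"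
    by (auto simp: frechet_derivative_works)
  show "b \<in> Basis \<Longrightarrow> grad \<phi> x \<bullet> b = frechet_derivative \<phi> (at x) b"
    by (simp add: grad_def)
qed

lemma test_function_continuous:
  assumes "\<phi> \<in> test_functions \<Omega>"
  shows "continuous_on UNIV \<phi>" "continuous_on UNIV (grad \<phi>)"
proof -
  show "continuous_on UNIV \<phi>"
    by (rule has_derivative_continuous_on[of UNIV \<phi> "\<lambda>x. frechet_derivative \<phi> (at x)"])
       (simp add: test_function_derivative(1)[OF assms])
  show "continuous_on UNIV (grad \<phi>)"
    unfolding grad_def using test_function_derivative(2)[OF assms] by (intro continuous_intros) auto
qed

text \<open>The product of the two test functions has compact support, so its directional derivative
  integrates to zero over the whole space; the integrand vanishes off \<open>\<Omega>\<close>, and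
  the product rule yields integration by parts.\<close>

lemma test_function_has_weak_gradient:
  fixes \<Omega> :: "'a::euclidean_space set"
  assumes \<Omega>: "open \<Omega>" "bounded \<Omega>" and \<phi>: "\<phi> \<in> test_functions \<Omega>"
  shows "has_weak_gradient \<Omega> \<phi> (grad \<phi>)"
  unfolding has_weak_gradient_def
proof (intro conjI ballI)
  note L2s = L2_continuous[OF \<Omega> test_function_continuous(1)] L2_continuous[OF \<Omega> test_function_continuous(2)]
  show L2\<phi>: "\<phi> \<in> L2 \<Omega>" "grad \<phi> \<in> L2 \<Omega>" using L2s[OF \<phi>] by auto
  fix \<psi> and b :: 'a
  assume \<psi>: "\<psi> \<in> test_functions \<Omega>" and b: "b \<in> Basis"
  have L2\<psi>: "\<psi> \<in> L2 \<Omega>" "grad \<psi> \<in> L2 \<Omega>" using L2s[OF \<psi>] by auto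
  define F' where "F' x v = \<phi> x * frechet_derivative \<psi> (at x) v + frechet_derivative \<phi> (at x) v * \<psi> x" for x v
  define K where "K = closure {x. \<phi> x \<noteq> 0}"
  have K: "compact K" "K \<subseteq> \<Omega>" using \<phi> by (auto simp: K_def test_functions_def)
  have outside: "\<phi> x = 0" if "x \<notin> K" for x using that closure_subset[of "{x. \<phi> x \<noteq> 0}"] by (auto simp: K_def)
  have d: "((\<lambda>x. \<phi> x * \<psi> x) has_derivative F' x) (at x)" for x
    unfolding F'_def
    by (intro has_derivative_mult test_function_derivative(1)[OF \<phi>] test_function_derivative(1)[OF \<psi>])
  have c: "continuous_on UNIV (\<lambda>x. F' x b)"
    unfolding F'_def
    by (intro continuous_intros test_function_continuous(1)[OF \<phi>] test_function_continuous(1)[OF \<psi>]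
        test_function_derivative(2)[OF \<phi> b] test_function_derivative(2)[OF \<psi> b])
  have "(LINT x|lborel. F' x b) = 0"
    by (rule integral_directional_derivative_eq_0[OF d c K(1)]) (simp add: outside)
  moreover have "F' x b = 0" if "x \<notin> \<Omega>" for x
  proof -
    have "(\<phi> has_derivative (\<lambda>_. 0)) (at x)"
      by (rule has_derivative_transform_within_open[where s="- K", OF has_derivative_const[of 0]])
         (use K outside that compact_imp_closed in auto)
    then have "frechet_derivative \<phi> (at x) = (\<lambda>_. 0)" by (rule frechet_derivative_eqI)
    moreover have "\<phi> x = 0" using outside K(2) that by auto
    ultimately show ?thesis by (simp add: F'_def)
  qed
  then have "(\<lambda>x. indicator \<Omega> x *\<^sub>R F' x b) = (\<lambda>x. F' x b)" by (fastforce simp: indicator_def)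
  then have "(LINT x|lebesgue_on \<Omega>. F' x b) = (LINT x|lborel. F' x b)"
    using \<Omega> borel_measurable_continuous_onI[OF c]
    by (subst integral_restrict_space) (auto simp: integral_completion)
  ultimately have "0 = (LINT x|lebesgue_on \<Omega>. F' x b)" by simp
  also have "\<dots> = (LINT x|lebesgue_on \<Omega>. \<phi> x * (grad \<psi> x \<bullet> b) + (grad \<phi> x \<bullet> b) * \<psi> x)"
    using b by (simp add: F'_def test_function_derivative(3)[OF \<phi>] test_function_derivative(3)[OF \<psi>])
  also have "\<dots> = (LINT x|lebesgue_on \<Omega>. \<phi> x * (grad \<psi> x \<bullet> b)) + (LINT x|lebesgue_on \<Omega>. (grad \<phi> x \<bullet> b) * \<psi> x)"
    using L2_integrable_inner[OF L2\<phi>(1) L2_component[OF L2\<psi>(2), of b]]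
      L2_integrable_inner[OF L2_component[OF L2\<phi>(2), of b] L2\<psi>(1)]
    by (intro Bochner_Integration.integral_add) auto
  finally show "(LINT x|lebesgue_on \<Omega>. \<phi> x * (grad \<psi> x \<bullet> b)) = - (LINT x|lebesgue_on \<Omega>. (grad \<phi> x \<bullet> b) * \<psi> x)"
    by simp
qed

section \<open>Uniqueness of weak gradients and Green's formula\<close>

lemma has_weak_gradient_diff:
  fixes v w :: "'a::euclidean_space \<Rightarrow> real"
  assumes \<Omega>: "open \<Omega>" "bounded \<Omega>" and v: "has_weak_gradient \<Omega> v G" and w: "has_weak_gradient \<Omega> w H"
  shows "has_weak_gradient \<Omega> (\<lambda>x. v x - w x) (\<lambda>x. G x - H x)"
  unfolding has_weak_gradient_def
proof (intro conjI ballI)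
  have L2s: "v \<in> L2 \<Omega>" "G \<in> L2 \<Omega>" "w \<in> L2 \<Omega>" "H \<in> L2 \<Omega>"
    using v w by (auto simp: has_weak_gradient_def)
  then show "(\<lambda>x. v x - w x) \<in> L2 \<Omega>" "(\<lambda>x. G x - H x) \<in> L2 \<Omega>" by (auto intro: L2_diff)
  fix \<phi> and b :: 'a assume \<phi>: "\<phi> \<in> test_functions \<Omega>" and b: "b \<in> Basis"
  have gb: "(\<lambda>x. grad \<phi> x \<bullet> b) \<in> L2 \<Omega>" and \<phi>L: "\<phi> \<in> L2 \<Omega>"
    using L2_continuous[OF \<Omega> test_function_continuous(1)[OF \<phi>]]
      L2_component[OF L2_continuous[OF \<Omega> test_function_continuous(2)[OF \<phi>]]] by auto
  note ints = L2_integrable_inner[OF L2s(1) gb] L2_integrable_inner[OF L2s(3) gb]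
    L2_integrable_inner[OF L2_component[OF L2s(2), of b] \<phi>L] L2_integrable_inner[OF L2_component[OF L2s(4), of b] \<phi>L]
  show "(LINT x|lebesgue_on \<Omega>. (v x - w x) * (grad \<phi> x \<bullet> b)) = - (LINT x|lebesgue_on \<Omega>. ((G x - H x) \<bullet> b) * \<phi> x)"
    using ints v w \<phi> b by (simp add: left_diff_distrib inner_diff_left has_weak_gradient_def)
qed

text \<open>The difference G - H is a weak gradient of the zero function, so each component is
  orthogonal to all test functions. This is what allows calculation with \<open>weak_grad\<close>, a
  chosen representative that need not respect differences pointwise.\<close>

lemma has_weak_gradient_unique:
  fixes v :: "'a::euclidean_space \<Rightarrow> real"
  assumes \<Omega>: "open \<Omega>" "bounded \<Omega>" and G: "has_weak_gradient \<Omega> v G" and H: "has_weak_gradient \<Omega> v H"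
  shows "AE x in lebesgue_on \<Omega>. G x = H x"
proof -
  have "has_weak_gradient \<Omega> (\<lambda>x. v x - v x) (\<lambda>x. G x - H x)"
    by (rule has_weak_gradient_diff[OF \<Omega> G H])
  then have D: "(\<lambda>x. G x - H x) \<in> L2 \<Omega>"
    "\<And>\<phi> b. \<phi> \<in> test_functions \<Omega> \<Longrightarrow> b \<in> Basis \<Longrightarrow> (LINT x|lebesgue_on \<Omega>. ((G x - H x) \<bullet> b) * \<phi> x) = 0"
    by (auto simp: has_weak_gradient_def)
  have "AE x in lebesgue_on \<Omega>. (G x - H x) \<bullet> b = 0" if "b \<in> Basis" for b
    using D that by (intro fundamental_lemma_test_functions L2_integrable L2_component \<Omega>) auto
  then have "AE x in lebesgue_on \<Omega>. \<forall>b\<in>Basis. (G x - H x) \<bullet> b = 0"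
    by (intro AE_finite_allI) auto
  then show ?thesis
    by eventually_elim (rule euclidean_eqI, simp add: inner_diff_left)
qed

lemma weak_grad_works: "v \<in> H1 \<Omega> \<Longrightarrow> has_weak_gradient \<Omega> v (weak_grad \<Omega> v)"
  by (simp add: H1_def weak_grad_def someI_ex)

lemma H1_L2: "v \<in> H1 \<Omega> \<Longrightarrow> v \<in> L2 \<Omega>" "v \<in> H1 \<Omega> \<Longrightarrow> weak_grad \<Omega> v \<in> L2 \<Omega>"
  using weak_grad_works by (auto simp: has_weak_gradient_def)

lemma H10_H1: "v \<in> H10 \<Omega> \<Longrightarrow> v \<in> H1 \<Omega>"
  by (simp add: H10_def)

lemma H1_norm_ge: "L2_norm \<Omega> v \<le> H1_norm \<Omega> v" "L2_norm \<Omega> (weak_grad \<Omega> v) \<le> H1_norm \<Omega> v"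
  unfolding H1_norm_def by (auto intro!: real_le_rsqrt)

lemma weak_laplacian_L2:
  assumes "v \<in> H2 \<Omega>"
  shows "weak_laplacian \<Omega> v \<in> L2 \<Omega>"
proof -
  have "weak_partial \<Omega> b (weak_partial \<Omega> b v) \<in> L2 \<Omega>" if "b \<in> Basis" for b
    using assms that unfolding weak_partial_def[of _ _ "weak_partial \<Omega> b v", abs_def]
    by (intro L2_component H1_L2) (auto simp: H2_def)
  then show ?thesis unfolding weak_laplacian_def[abs_def] by (rule L2_sum)
qed

text \<open>The defining identity of the weak gradient is applied to each
  \<open>weak_partial \<Omega> b v\<close>, which lies in \<open>H1\<close> because v lies in
  \<open>H2\<close>, and summed over the directions.\<close>

lemma Green_test_function:
  fixes \<Omega> :: "'a::euclidean_space set"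
  assumes \<Omega>: "open \<Omega>" "bounded \<Omega>" and v: "v \<in> H2 \<Omega>" and \<phi>: "\<phi> \<in> test_functions \<Omega>"
  shows "L2_inner \<Omega> (weak_grad \<Omega> v) (grad \<phi>) = - L2_inner \<Omega> (weak_laplacian \<Omega> v) \<phi>"
proof -
  have gv: "weak_grad \<Omega> v \<in> L2 \<Omega>" using v H1_L2(2)[of v \<Omega>] by (simp add: H2_def)
  have g\<phi>: "grad \<phi> \<in> L2 \<Omega>" and \<phi>L: "\<phi> \<in> L2 \<Omega>"
    using L2_continuous[OF \<Omega>] test_function_continuous[OF \<phi>] by auto
  have pv: "weak_partial \<Omega> b v \<in> H1 \<Omega>" if "b \<in> Basis" for b using v that by (auto simp: H2_def)
  have ppv: "weak_partial \<Omega> b (weak_partial \<Omega> b v) \<in> L2 \<Omega>" if "b \<in> Basis" for b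
    unfolding weak_partial_def[of _ _ "weak_partial \<Omega> b v", abs_def]
    by (intro L2_component H1_L2 pv that)
  have "L2_inner \<Omega> (weak_grad \<Omega> v) (grad \<phi>) =
      (\<Sum>b\<in>Basis. LINT x|lebesgue_on \<Omega>. weak_partial \<Omega> b v x * (grad \<phi> x \<bullet> b))"
    unfolding L2_inner_def weak_partial_def
    using L2_integrable_inner[OF L2_component[OF gv] L2_component[OF g\<phi>]]
    by (subst euclidean_inner) (simp add: Bochner_Integration.integral_sum)
  also have "\<dots> = (\<Sum>b\<in>Basis. - (LINT x|lebesgue_on \<Omega>. weak_partial \<Omega> b (weak_partial \<Omega> b v) x * \<phi> x))"
    using weak_grad_works[OF pv] \<phi>
    by (intro sum.cong) (auto simp: has_weak_gradient_def weak_partial_def[of _ _ "weak_partial \<Omega> _ v"])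
  also have "\<dots> = - (\<Sum>b\<in>Basis. L2_inner \<Omega> (weak_partial \<Omega> b (weak_partial \<Omega> b v)) \<phi>)"
    by (simp add: L2_inner_def sum_negf)
  also have "\<dots> = - L2_inner \<Omega> (weak_laplacian \<Omega> v) \<phi>"
    unfolding weak_laplacian_def[abs_def] using ppv \<phi>L by (subst L2_inner_sum_left) auto
  finally show ?thesis .
qed

text \<open>Both sides depend continuously on w in the \<open>H1\<close> norm, so approximation by
  test functions transfers the formula. Here the zero boundary values of w do their work: no
  boundary integral arises.\<close>

lemma Green_H10:
  fixes \<Omega> :: "'a::euclidean_space set"
  assumes \<Omega>: "open \<Omega>" "bounded \<Omega>" and v: "v \<in> H2 \<Omega>" and w: "w \<in> H10 \<Omega>"
  shows "L2_inner \<Omega> (weak_grad \<Omega> v) (weak_grad \<Omega> w) = - L2_inner \<Omega> (weak_laplacian \<Omega> v) w"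
proof -
  obtain \<phi> where \<phi>: "\<And>n. \<phi> n \<in> test_functions \<Omega>" "(\<lambda>n. H1_norm \<Omega> (\<lambda>x. w x - \<phi> n x)) \<longlonglongrightarrow> 0"
    using w by (auto simp: H10_def)
  have wL: "w \<in> L2 \<Omega>" "weak_grad \<Omega> w \<in> L2 \<Omega>" using H1_L2[OF H10_H1[OF w]] by auto
  have vL: "weak_grad \<Omega> v \<in> L2 \<Omega>" "weak_laplacian \<Omega> v \<in> L2 \<Omega>"
    using v H1_L2(2)[of v \<Omega>] weak_laplacian_L2 by (auto simp: H2_def)
  let ?d = "L2_inner \<Omega> (weak_grad \<Omega> v) (weak_grad \<Omega> w) + L2_inner \<Omega> (weak_laplacian \<Omega> v) w"
  let ?C = "L2_norm \<Omega> (weak_grad \<Omega> v) + L2_norm \<Omega> (weak_laplacian \<Omega> v)"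
  have "\<bar>?d\<bar> \<le> ?C * H1_norm \<Omega> (\<lambda>x. w x - \<phi> n x)" for n
  proof -
    have \<phi>L: "\<phi> n \<in> L2 \<Omega>" "grad (\<phi> n) \<in> L2 \<Omega>"
      using L2_continuous[OF \<Omega>] test_function_continuous[OF \<phi>(1)] by auto
    have wg: "has_weak_gradient \<Omega> (\<lambda>x. w x - \<phi> n x) (\<lambda>x. weak_grad \<Omega> w x - grad (\<phi> n) x)"
      using w by (intro has_weak_gradient_diff weak_grad_works test_function_has_weak_gradient \<Omega> \<phi> H10_H1)
    then have H1: "(\<lambda>x. w x - \<phi> n x) \<in> H1 \<Omega>" by (auto simp: H1_def)
    have dL: "(\<lambda>x. weak_grad \<Omega> w x - grad (\<phi> n) x) \<in> L2 \<Omega>" "(\<lambda>x. w x - \<phi> n x) \<in> L2 \<Omega>"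
      using wL \<phi>L by (auto intro: L2_diff)
    \<comment> \<open>\<open>H1_norm\<close> sees the representative chosen for the difference;
      uniqueness identifies its norm with that of the difference of the gradients.\<close>
    have "L2_norm \<Omega> (\<lambda>x. weak_grad \<Omega> w x - grad (\<phi> n) x) = L2_norm \<Omega> (weak_grad \<Omega> (\<lambda>x. w x - \<phi> n x))"
      by (rule L2_norm_cong_AE[OF dL(1) H1_L2(2)[OF H1] has_weak_gradient_unique[OF \<Omega> wg weak_grad_works[OF H1]]])
    then have le: "L2_norm \<Omega> (\<lambda>x. weak_grad \<Omega> w x - grad (\<phi> n) x) \<le> H1_norm \<Omega> (\<lambda>x. w x - \<phi> n x)"
      using H1_norm_ge(2)[of \<Omega> "\<lambda>x. w x - \<phi> n x"] by simp
    have "?d = L2_inner \<Omega> (weak_grad \<Omega> v) (\<lambda>x. weak_grad \<Omega> w x - grad (\<phi> n) x) +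
        L2_inner \<Omega> (weak_laplacian \<Omega> v) (\<lambda>x. w x - \<phi> n x)"
      using Green_test_function[OF \<Omega> v \<phi>(1)[of n]] vL wL \<phi>L by (simp add: L2_inner_diff_right)
    also have "\<bar>\<dots>\<bar> \<le> L2_norm \<Omega> (weak_grad \<Omega> v) * L2_norm \<Omega> (\<lambda>x. weak_grad \<Omega> w x - grad (\<phi> n) x) +
        L2_norm \<Omega> (weak_laplacian \<Omega> v) * L2_norm \<Omega> (\<lambda>x. w x - \<phi> n x)"
      using L2_inner_le_norm[OF vL(1) dL(1)] L2_inner_le_norm[OF vL(2) dL(2)] by linarith
    also have "\<dots> \<le> L2_norm \<Omega> (weak_grad \<Omega> v) * H1_norm \<Omega> (\<lambda>x. w x - \<phi> n x) +
        L2_norm \<Omega> (weak_laplacian \<Omega> v) * H1_norm \<Omega> (\<lambda>x. w x - \<phi> n x)"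
      using le H1_norm_ge(1) by (intro add_mono mult_left_mono) (auto intro: L2_norm_nonneg)
    finally show ?thesis by (simp add: algebra_simps)
  qed
  moreover have "(\<lambda>n. ?C * H1_norm \<Omega> (\<lambda>x. w x - \<phi> n x)) \<longlonglongrightarrow> ?C * 0"
    by (intro tendsto_mult_left \<phi>(2))
  ultimately have "\<bar>?d\<bar> \<le> ?C * 0" by (intro LIMSEQ_le_const) auto
  then show ?thesis by simp
qed

section \<open>Discrete orthogonal convolution kernels and stability\<close>

text \<open>\<open>doc_kernel t k j\<close> is \<open>\<theta>\<close> with upper index \<open>k\<close> and lower index \<open>k - j\<close>, i.e. the
  \<open>(k, j)\<close> entry of the inverse of the lower bidiagonal matrix of BDF2 kernels; it is meaningful for
  \<open>1 \<le> j \<le> k\<close>.\<close>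

fun doc_kernel :: "(nat \<Rightarrow> real) \<Rightarrow> nat \<Rightarrow> nat \<Rightarrow> real" where
  "doc_kernel t 0 j = 0"
| "doc_kernel t (Suc k) j =
     (if j = Suc k then 1 / bdf2_kernel t (Suc k) 0
      else - bdf2_kernel t (Suc k) 1 / bdf2_kernel t (Suc k) 0 * doc_kernel t k j)"

definition doc_sum :: "(nat \<Rightarrow> real) \<Rightarrow> (nat \<Rightarrow> real) \<Rightarrow> nat \<Rightarrow> real" where
  "doc_sum t x k = (\<Sum>j=1..k. doc_kernel t k j * x j)"

lemma doc_sum_0 [simp]: "doc_sum t x 0 = 0"
  by (simp add: doc_sum_def)

text \<open>This is forward substitution: with b_0, b_1 the two kernels of level k, y_k =
  \<open>doc_sum t x k\<close> solves b_0 y_k + b_1 y_(k-1) = x_k.\<close>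

lemma doc_sum_Suc:
  "doc_sum t x (Suc k) = (x (Suc k) - bdf2_kernel t (Suc k) 1 * doc_sum t x k) / bdf2_kernel t (Suc k) 0"
proof -
  have "(\<Sum>j=1..k. doc_kernel t (Suc k) j * x j) =
      (\<Sum>j=1..k. - bdf2_kernel t (Suc k) 1 / bdf2_kernel t (Suc k) 0 * (doc_kernel t k j * x j))"
    by (intro sum.cong) auto
  then show ?thesis
    unfolding doc_sum_def
    by (simp add: sum_distrib_left[symmetric] sum_negf sum_divide_distrib[symmetric] diff_divide_distrib)
qed

lemma doc_sum_add: "doc_sum t (\<lambda>j. x j + y j) k = doc_sum t x k + doc_sum t y k"
  by (simp add: doc_sum_def distrib_left sum.distrib)

lemma doc_sum_cmult: "doc_sum t (\<lambda>j. c * x j) k = c * doc_sum t x k"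
  by (simp add: doc_sum_def sum_distrib_left mult.left_commute)

lemma doc_sum_cong: "(\<And>j. j \<in> {1..k} \<Longrightarrow> x j = y j) \<Longrightarrow> doc_sum t x k = doc_sum t y k"
  by (simp add: doc_sum_def)

text \<open>The convention that \<open>bdf2_kernel t 1 1\<close> is zero lets the two-term formula
  cover n = 1, where \<open>w 0\<close> carries the coefficient 0.\<close>

lemma sum_bdf2_kernel:
  assumes "1 \<le> n"
  shows "(\<Sum>j=1..n. bdf2_kernel t n (n - j) * w j) = bdf2_kernel t n 0 * w n + bdf2_kernel t n 1 * w (n - 1)"
proof (cases "n = 1")
  case True
  then show ?thesis by (simp add: bdf2_kernel_def)
next
  case False
  with assms have n: "n \<ge> 2" by simp
  have "(\<Sum>j=1..n. bdf2_kernel t n (n - j) * w j) = (\<Sum>j\<in>{n - 1, n}. bdf2_kernel t n (n - j) * w j)"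
    using n by (intro sum.mono_neutral_right) (auto simp: bdf2_kernel_def)
  with n show ?thesis by auto
qed

section \<open>Inverse, sign, row sums and positivity of the kernels on a mesh\<close>

locale mesh =
  fixes T :: real and N :: nat and t :: "nat \<Rightarrow> real"
  assumes mesh: "time_mesh T N t"
begin

lemma t_0 [simp]: "t 0 = 0" and t_N: "t N = T"
  using mesh by (auto simp: time_mesh_def)

lemma step_pos: "1 \<le> k \<Longrightarrow> k \<le> N \<Longrightarrow> 0 < step t k"
  using mesh by (cases k) (auto simp: time_mesh_def step_def)

lemma t_strict_mono: "i < j \<Longrightarrow> j \<le> N \<Longrightarrow> t i < t j"
proof (induction j)
  case (Suc j)
  then have "t j < t (Suc j)" using mesh by (auto simp: time_mesh_def)
  with Suc show ?case by (cases "i = j") auto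
qed simp

lemma t_mono: "i \<le> j \<Longrightarrow> j \<le> N \<Longrightarrow> t i \<le> t j"
  using t_strict_mono[of i j] by (cases "i = j") auto

lemma t_nonneg: "j \<le> N \<Longrightarrow> 0 \<le> t j"
  using t_mono[of 0 j] by simp

lemma t_le_T: "j \<le> N \<Longrightarrow> t j \<le> T"
  using t_mono[of j N] t_N by simp

lemma ratio_pos: "2 \<le> k \<Longrightarrow> k \<le> N \<Longrightarrow> 0 < ratio t k"
  using step_pos[of k] step_pos[of "k - 1"] by (auto simp: ratio_def)

lemma bdf2_kernel_pos: "1 \<le> k \<Longrightarrow> k \<le> N \<Longrightarrow> 0 < bdf2_kernel t k 0"
  using step_pos[of k] ratio_pos[of k] by (auto simp: bdf2_kernel_def)

lemma bdf2_kernel_1_nonpos: "1 \<le> k \<Longrightarrow> k \<le> N \<Longrightarrow> bdf2_kernel t k 1 \<le> 0"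
  using step_pos[of k] ratio_pos[of k] by (auto simp: bdf2_kernel_def)

lemma doc_sum_inverts:
  assumes "k \<le> N" "1 \<le> k"
    and "\<And>j. j \<in> {1..k} \<Longrightarrow> x j = (\<Sum>i=1..j. bdf2_kernel t j (j - i) * y i)"
  shows "doc_sum t x k = y k"
  using assms
proof (induction k)
  case (Suc k)
  have "x (Suc k) = bdf2_kernel t (Suc k) 0 * y (Suc k) + bdf2_kernel t (Suc k) 1 * y k"
    using Suc.prems(3)[of "Suc k"] sum_bdf2_kernel[of "Suc k" t y] by auto
  \<comment> \<open>For k = 0 the values \<open>doc_sum t x 0\<close> and \<open>y 0\<close> may
    differ, but their coefficient is zero.\<close>
  moreover have "bdf2_kernel t (Suc k) 1 * doc_sum t x k = bdf2_kernel t (Suc k) 1 * y k"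
    using Suc by (cases "k = 0") (auto simp: bdf2_kernel_def)
  ultimately have "x (Suc k) - bdf2_kernel t (Suc k) 1 * doc_sum t x k = bdf2_kernel t (Suc k) 0 * y (Suc k)"
    by linarith
  then show ?case
    using bdf2_kernel_pos[of "Suc k"] Suc.prems(1,2) by (simp add: doc_sum_Suc)
qed simp

text \<open>The formula differentiates the function s |-> s exactly: its increments are the steps
  and its derivative is 1. Inverting the relation shows that row k of the inverse kernels sums to
  \<open>step t k\<close>.\<close>

lemma sum_bdf2_kernel_step:
  assumes "1 \<le> n" "n \<le> N"
  shows "(\<Sum>j=1..n. bdf2_kernel t n (n - j) * step t j) = 1"
proof (cases "n = 1")
  case True
  then show ?thesis using step_pos[of 1] assms by (simp add: bdf2_kernel_def)
next
  case False
  with assms have n: "2 \<le> n" by simp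
  define r where "r = ratio t n"
  have r: "r > 0" and s: "step t n > 0" and s1: "step t (n - 1) = step t n / r"
    using ratio_pos[of n] step_pos[of n] step_pos[of "n - 1"] n assms by (auto simp: r_def ratio_def)
  have "(1 + 2 * r) / (step t n * (1 + r)) * step t n + - (r\<^sup>2 / (step t n * (1 + r))) * (step t n / r) = 1"
    using r s by (simp add: divide_simps) (simp add: algebra_simps power2_eq_square)
  then show ?thesis
    unfolding sum_bdf2_kernel[OF assms(1)] s1 using n by (simp add: bdf2_kernel_def flip: r_def)
qed

lemma doc_sum_1: "1 \<le> k \<Longrightarrow> k \<le> N \<Longrightarrow> doc_sum t (\<lambda>_. c) k = c * step t k"
  using doc_sum_inverts[of k "\<lambda>_. 1" "step t"] sum_bdf2_kernel_step doc_sum_cmult[of t c "\<lambda>_. 1"]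
  by simp

text \<open>The matrix of BDF2 kernels has a positive diagonal and a nonpositive subdiagonal, so the
  recursion for its inverse only multiplies nonnegative numbers.\<close>

lemma doc_kernel_nonneg: "k \<le> N \<Longrightarrow> 0 \<le> doc_kernel t k j"
proof (induction k)
  case (Suc k)
  then show ?case
    using bdf2_kernel_pos[of "Suc k"] bdf2_kernel_1_nonpos[of "Suc k"]
    by (auto intro!: mult_nonpos_nonneg divide_nonpos_pos simp: )
qed simp

lemma doc_sum_mono: "k \<le> N \<Longrightarrow> (\<And>j. j \<in> {1..k} \<Longrightarrow> x j \<le> y j) \<Longrightarrow> doc_sum t x k \<le> doc_sum t y k"
  unfolding doc_sum_def by (intro sum_mono mult_left_mono doc_kernel_nonneg)

text \<open>With B the matrix of BDF2 kernels and x = B y, the form of the inverse at x equals the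
  form of B at y.\<close>

lemma doc_sum_psd:
  assumes psd: "bdf2_kernels_psd N t" and "n \<le> N"
  shows "0 \<le> (\<Sum>k=1..n. x k * doc_sum t x k)"
proof (cases "n = 0")
  case False
  have "x k = (\<Sum>j=1..k. bdf2_kernel t k (k - j) * doc_sum t x j)" if "k \<in> {1..n}" for k
    using that bdf2_kernel_pos[of k] \<open>n \<le> N\<close> doc_sum_Suc[of t x "k - 1"]
    by (subst sum_bdf2_kernel) auto
  then have "(\<Sum>k=1..n. x k * doc_sum t x k) =
      (\<Sum>k=1..n. doc_sum t x k * (\<Sum>j=1..k. bdf2_kernel t k (k - j) * doc_sum t x j))"
    by (intro sum.cong) (auto simp: mult.commute)
  also have "\<dots> \<ge> 0"
    using psd False \<open>n \<le> N\<close> by (auto simp: bdf2_kernels_psd_def)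
  finally show ?thesis .
qed simp

text \<open>With \<open>R = (3 + sqrt 17) / 2\<close>, the positive root of \<open>R\<^sup>2 = 3 R + 2\<close>, and \<open>c = R / (1 + R)\<close>,
  the quadratic form dominates \<open>c w\<^sub>n\<^sup>2 / (2 \<tau>\<^sub>n)\<close>.\<close>

lemma bdf2_kernels_psd_of_ratio:
  assumes "\<forall>k\<in>{2..N}. 0 < ratio t k \<and> ratio t k \<le> (3 + sqrt 17) / 2"
  shows "bdf2_kernels_psd N t"
  unfolding bdf2_kernels_psd_def
proof (intro ballI allI)
  fix n and w :: "nat \<Rightarrow> real"
  assume "n \<in> {1..N}"
  define R where "R = (3 + sqrt 17) / (2::real)"
  define c where "c = R / (1 + R)"
  have "sqrt 17 \<ge> sqrt (4\<^sup>2)" by (rule real_sqrt_le_mono) simp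
  then have R: "R \<ge> 2" by (simp add: R_def)
  have R2: "R * R = 3 * R + 2" by (simp add: R_def field_simps)
  have c: "0 \<le> c" "c \<le> 1" using R by (auto simp: c_def)
  have "1 \<le> n" "n \<le> N" using \<open>n \<in> {1..N}\<close> by auto
  then have "(\<Sum>k=1..n. w k * (\<Sum>j=1..k. bdf2_kernel t k (k - j) * w j)) \<ge> c * (w n)\<^sup>2 / (2 * step t n)"
  proof (induction n rule: nat_induct_at_least)
    case base
    have "c * (w 1)\<^sup>2 / (2 * step t 1) \<le> 2 * (w 1)\<^sup>2 / (2 * step t 1)"
      using c step_pos[of 1] base by (intro divide_right_mono mult_right_mono) auto
    then show ?case using step_pos[of 1] base by (simp add: bdf2_kernel_def power2_eq_square)
  next
    case (Suc n)
    define r s a b where "r = ratio t (Suc n)" "s = step t (Suc n)" "a = w (Suc n)" "b = w n"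
    note defs = this
    have r: "0 < r" "r \<le> R" using assms Suc by (auto simp: defs R_def)
    have s: "s > 0" and sn: "step t n = s / r"
      using step_pos[of "Suc n"] step_pos[of n] Suc by (auto simp: defs ratio_def)
    \<comment> \<open>The map r |-> r / (1 + r) is increasing, and c is its value at R.\<close>
    have c1: "r \<le> c * (1 + r)"
      using r R by (simp add: c_def field_simps)
    have "0 \<le> (1 + R) * r" using r R by simp
    \<comment> \<open>The gap in the inequality c2, multiplied by 1 + R, is a concave quadratic in r
      that vanishes at r = R exactly because R^2 = 3 R + 2. Splitting off R - r leaves a factor that
      is nonnegative since R >= 2.\<close>
    then have "0 \<le> (R - r) * ((1 + R) * r + R - 2)" using r R by (intro mult_nonneg_nonneg) linarith+
    also have "\<dots> = (1 + R) * (2 + 4 * r - r\<^sup>2) - R * (1 + r)"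
      using R2 by (simp add: algebra_simps power2_eq_square) (algebra)
    finally have c2: "c * (1 + r) \<le> 2 + 4 * r - r\<^sup>2"
      using R by (simp add: c_def field_simps)
    have "c * (1 + r) * a\<^sup>2 \<le> (2 + 4 * r - r\<^sup>2) * a\<^sup>2" using c2 by (intro mult_right_mono) auto
    \<comment> \<open>The square supplies the mixed term -2 r^2 a b. Its r^2 b^2 is paid for by the
      lower bound c b^2 / (2 tau_n) of the previous level, which reads c (1 + r) r b^2 after
      multiplication by 2 s (1 + r).\<close>
    also have "\<dots> \<le> (2 + 4 * r - r\<^sup>2) * a\<^sup>2 + r\<^sup>2 * (a - b)\<^sup>2 + (c * (1 + r) - r) * (r * b\<^sup>2)"
      using c1 r by auto
    also have "\<dots> = 2 * ((1 + 2 * r) * a\<^sup>2 - r\<^sup>2 * (a * b)) + c * (1 + r) * (r * b\<^sup>2)"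
      by (simp add: algebra_simps power2_eq_square)
    finally have "c * a\<^sup>2 / (2 * s) \<le> a * ((1 + 2 * r) / (s * (1 + r)) * a + - (r\<^sup>2 / (s * (1 + r))) * b) + c * b\<^sup>2 / (2 * (s / r))"
      using r s by (simp add: divide_simps) (simp add: algebra_simps power2_eq_square)
    moreover have "(\<Sum>j=1..Suc n. bdf2_kernel t (Suc n) (Suc n - j) * w j) =
        (1 + 2 * r) / (s * (1 + r)) * a + - (r\<^sup>2 / (s * (1 + r))) * b"
      using Suc.hyps by (subst sum_bdf2_kernel) (auto simp: bdf2_kernel_def defs)
    moreover have "(\<Sum>k=1..n. w k * (\<Sum>j=1..k. bdf2_kernel t k (k - j) * w j)) \<ge> c * b\<^sup>2 / (2 * (s / r))"
      using Suc by (simp add: sn defs(4) flip: sn)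
    ultimately show ?case using Suc.hyps
      by (simp add: defs(2,3) flip: defs(2,3))
  qed
  moreover have "c * (w n)\<^sup>2 / (2 * step t n) \<ge> 0"
    using c step_pos[of n] \<open>1 \<le> n\<close> \<open>n \<le> N\<close> by simp
  ultimately show "0 \<le> (\<Sum>k=1..n. w k * (\<Sum>j=1..k. bdf2_kernel t k (k - j) * w j))" by linarith
qed

section \<open>A discrete Gronwall inequality and the abstract stability estimate\<close>

lemma sum_step: "m \<le> Suc i \<Longrightarrow> 1 \<le> m \<Longrightarrow> (\<Sum>k=m..i. step t k) = t i - t (m - 1)"
proof (induction i)
  case (Suc i)
  then show ?case by (cases "m = Suc (Suc i)") (auto simp: step_def)
qed (auto simp: le_Suc_eq)

text \<open>The sum in the hypothesis contains x i itself with a coefficient of at most 1/2. Moving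
  that term to the left doubles D and c and leaves an explicit inequality whose sum stops at i -
  1.\<close>

lemma discrete_gronwall:
  fixes x :: "nat \<Rightarrow> real"
  assumes "1 \<le> m" "m \<le> n" "n \<le> N" "0 \<le> c" "0 \<le> D"
    and nonneg: "\<And>i. 0 \<le> x i"
    and small: "\<And>k. k \<in> {m..n} \<Longrightarrow> c * step t k \<le> 1 / 4"
    and bound: "\<And>i. i \<in> {m..n} \<Longrightarrow> x i \<le> D + 2 * c * (\<Sum>k=m..i. step t k * x k)"
  shows "x n \<le> 2 * exp (4 * c * t (n - 1)) * D"
proof -
  \<comment> \<open>This is the right side after absorption; it obeys S (i + 1) <= (1 + 4 c
    tau_(i+1)) S i, whence the exponential.\<close>
  define S where "S i = 2 * D + 4 * c * (\<Sum>k=m..i. step t k * x k)" for i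
  have x_le: "x i \<le> S (i - 1)" if i: "i \<in> {m..n}" for i
  proof -
    have "(\<Sum>k=m..i. step t k * x k) = (\<Sum>k=m..i-1. step t k * x k) + step t i * x i"
      using i \<open>1 \<le> m\<close> by (cases i) auto
    then have "x i \<le> S (i - 1) / 2 + 2 * (c * step t i) * x i"
      using bound[OF i] by (simp add: S_def algebra_simps add_divide_distrib)
    also have "\<dots> \<le> S (i - 1) / 2 + 2 * (1 / 4) * x i"
      using small[OF i] nonneg[of i] by (intro add_left_mono mult_right_mono mult_left_mono) auto
    finally show ?thesis by simp
  qed
  have S_le: "S i \<le> 2 * D * exp (4 * c * (t i - t (m - 1)))" if "m - 1 \<le> i" "i < n" for i
    using that
  proof (induction i rule: dec_induct)
    case base
    show ?case using \<open>1 \<le> m\<close> by (simp add: S_def)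
  next
    case (step i)
    have i: "Suc i \<in> {m..n}" using step \<open>1 \<le> m\<close> by auto
    have "S (Suc i) = S i + 4 * (c * step t (Suc i)) * x (Suc i)"
      using i by (simp add: S_def algebra_simps)
    also have "\<dots> \<le> S i + 4 * (c * step t (Suc i)) * S i"
      using x_le[OF i] step_pos[of "Suc i"] \<open>0 \<le> c\<close> \<open>n \<le> N\<close> i
      by (intro add_left_mono mult_left_mono mult_nonneg_nonneg) auto
    also have "\<dots> = S i * (1 + 4 * c * step t (Suc i))" by (simp add: algebra_simps)
    also have "\<dots> \<le> S i * exp (4 * c * step t (Suc i))"
      using x_le[OF i] nonneg[of "Suc i"] by (intro mult_left_mono exp_ge_add_one_self) auto
    also have "\<dots> \<le> (2 * D * exp (4 * c * (t i - t (m - 1)))) * exp (4 * c * step t (Suc i))"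
      using step by (intro mult_right_mono) auto
    also have "\<dots> = 2 * D * exp (4 * c * (t (Suc i) - t (m - 1)))"
      by (simp add: mult.assoc exp_add[symmetric] step_def algebra_simps)
    finally show ?case .
  qed
  have "x n \<le> 2 * D * exp (4 * c * (t (n - 1) - t (m - 1)))"
  proof -
    have "n \<in> {m..n}" "m - 1 \<le> n - 1" "n - 1 < n" using assms(1,2) by auto
    with x_le S_le show ?thesis by (meson order_trans)
  qed
  also have "\<dots> \<le> 2 * D * exp (4 * c * t (n - 1))"
    using \<open>0 \<le> D\<close> \<open>0 \<le> c\<close> t_nonneg[of "m - 1"] assms(2,3) by (auto intro!: mult_left_mono)
  finally show ?thesis by (simp add: mult_ac)
qed

text \<open>In the application \<open>A i k\<close> is the inner product of the errors \<open>e i\<close> and \<open>e k\<close>, \<open>a k\<close> is the norm of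
  \<open>e k\<close>, and \<open>Q\<close> is the diffusion term; levels \<open>j < m\<close> carry no equation and are absorbed in \<open>F\<close>.\<close>

lemma bdf2_stability:
  fixes A Q F :: "nat \<Rightarrow> nat \<Rightarrow> real" and a :: "nat \<Rightarrow> real"
  assumes m: "1 \<le> m" "m \<le> n" "n \<le> N" and "0 \<le> c" "0 \<le> G"
    and small: "\<And>k. k \<in> {m..n} \<Longrightarrow> c * step t k \<le> 1 / 4"
    and a: "\<And>k. 0 \<le> a k" "\<And>k. A k k = (a k)\<^sup>2"
      "\<And>i k. i \<le> n \<Longrightarrow> k \<le> n \<Longrightarrow> A i k \<le> a i * a k"
    and psd: "\<And>i. i \<in> {m..n} \<Longrightarrow> 0 \<le> (\<Sum>k=m..i. doc_sum t (\<lambda>j. Q j k) k)"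
    and eq: "\<And>j k. k \<in> {m..n} \<Longrightarrow> j \<in> {1..k} \<Longrightarrow>
      (\<Sum>i=1..j. bdf2_kernel t j (j - i) * (A i k - A (i - 1) k)) + Q j k = F j k"
    and F: "\<And>j k. k \<in> {m..n} \<Longrightarrow> j \<in> {1..k} \<Longrightarrow> F j k \<le> (c * (if m \<le> j then a j else 0) + G) * a k"
  shows "a n \<le> 2 * exp (4 * c * t (n - 1)) * (a (m - 1) + 2 * t n * G)"
proof -
  \<comment> \<open>Since 2 <e^k - e^(k-1), e^k> >= |e^k|^2 - |e^(k-1)|^2, the convolved equations
    telescope.\<close>
  have energy: "(a i)\<^sup>2 \<le> (a (m - 1))\<^sup>2 + 2 * (\<Sum>k=m..i. doc_sum t (\<lambda>j. F j k) k)"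
    if i: "i \<in> {m..n}" for i
  proof -
    have "(a k)\<^sup>2 - (a (k - 1))\<^sup>2 \<le> 2 * (doc_sum t (\<lambda>j. F j k) k - doc_sum t (\<lambda>j. Q j k) k)"
      if k: "k \<in> {m..i}" for k
    proof -
      have k': "1 \<le> k" "k \<le> N" "k \<in> {m..n}" using k i m by auto
      have "doc_sum t (\<lambda>j. F j k) k = doc_sum t (\<lambda>j. (\<Sum>i=1..j. bdf2_kernel t j (j - i) * (A i k - A (i - 1) k)) + Q j k) k"
        using eq k'(3) by (intro doc_sum_cong) auto
      also have "\<dots> = (A k k - A (k - 1) k) + doc_sum t (\<lambda>j. Q j k) k"
        unfolding doc_sum_add using k' by (subst doc_sum_inverts[where y="\<lambda>i. A i k - A (i - 1) k"]) auto
      finally have "doc_sum t (\<lambda>j. F j k) k - doc_sum t (\<lambda>j. Q j k) k = A k k - A (k - 1) k" by simp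
      moreover have "2 * A (k - 1) k \<le> (a k)\<^sup>2 + (a (k - 1))\<^sup>2"
        using a(3)[of "k - 1" k] k'(3) sum_squares_bound[of "a (k - 1)" "a k"] by force
      ultimately show ?thesis using a(2)[of k] by simp
    qed
    then have "(\<Sum>k=m..i. (a k)\<^sup>2 - (a (k - 1))\<^sup>2) \<le>
        (\<Sum>k=m..i. 2 * (doc_sum t (\<lambda>j. F j k) k - doc_sum t (\<lambda>j. Q j k) k))"
      by (rule sum_mono)
    also have "\<dots> = 2 * (\<Sum>k=m..i. doc_sum t (\<lambda>j. F j k) k) - 2 * (\<Sum>k=m..i. doc_sum t (\<lambda>j. Q j k) k)"
      by (simp add: sum_distrib_left[symmetric] sum_subtractf algebra_simps)
    also have "\<dots> \<le> 2 * (\<Sum>k=m..i. doc_sum t (\<lambda>j. F j k) k)" using psd[OF i] by simp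
    also have "(\<Sum>k=m..i. (a k)\<^sup>2 - (a (k - 1))\<^sup>2) = (a i)\<^sup>2 - (a (m - 1))\<^sup>2"
    proof -
      have "m \<le> i" using i by simp
      then show ?thesis
        by (induction i rule: dec_induct) simp_all
    qed
    finally show ?thesis by simp
  qed
  \<comment> \<open>The sources at level k involve all a j with j <= k, weighted by the inverse
    kernels. Bounding every a j by a maximum leaves only the row sum \<open>step t k\<close> of
    these weights.\<close>
  define M where "M i = Max (a ` {m - 1..i})" for i
  have M_ge: "a j \<le> M i" if "m - 1 \<le> j" "j \<le> i" for i j
    using that by (auto simp: M_def intro!: Max_ge)
  define D where "D = a (m - 1) + 2 * t n * G"
  have D: "a (m - 1) \<le> D" "0 \<le> D" using a(1)[of "m - 1"] t_nonneg[of n] m \<open>0 \<le> G\<close> by (auto simp: D_def)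
  have M_bound: "M i \<le> D + 2 * c * (\<Sum>k=m..i. step t k * M k)" if i: "i \<in> {m..n}" for i
  proof -
    have nn: "0 \<le> step t k * M k" "0 \<le> step t k" "0 \<le> M k" if "k \<in> {m..i}" for k
    proof -
      show s: "0 \<le> step t k" using step_pos[of k] that i m by auto
      show "0 \<le> M k" using M_ge[of k k] a(1)[of k] that by force
      with s show "0 \<le> step t k * M k" by simp
    qed
    have "M i \<in> a ` {m - 1..i}" unfolding M_def using i by (intro Max_in) auto
    then obtain p where p: "p \<in> {m - 1..i}" "M i = a p" by auto
    show ?thesis
    \<comment> \<open>The energy inequality is used at the level p where the maximum is attained,
      with the aim of cancelling M i. Level m - 1 has no such inequality, but there the maximum is
      the initial term itself.\<close>
    proof (cases "p = m - 1 \<or> M i = 0")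
      case True
      have "0 \<le> c * (\<Sum>k=m..i. step t k * M k)" using nn \<open>0 \<le> c\<close> by (intro mult_nonneg_nonneg sum_nonneg)
      with True D p show ?thesis by auto
    next
      case False
      with p i m have p': "p \<in> {m..n}" "p \<le> i" by auto
      have Mpos: "M i > 0" using False p a(1)[of p] by auto
      have "doc_sum t (\<lambda>j. F j k) k \<le> (c * (step t k * M k) + G * step t k) * M i" if k: "k \<in> {m..p}" for k
      proof -
        have k': "1 \<le> k" "k \<le> N" "k \<in> {m..n}" "k \<in> {m..i}" using k p' m i by auto
        have "doc_sum t (\<lambda>j. F j k) k \<le> doc_sum t (\<lambda>j. (c * M k + G) * a k) k"
        proof (rule doc_sum_mono[OF k'(2)])
          fix j assume j: "j \<in> {1..k}"
          have "(if m \<le> j then a j else 0) \<le> M k"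
            using M_ge[of j k] j nn(3)[OF k'(4)] by auto
          then show "F j k \<le> (c * M k + G) * a k"
            using F[OF k'(3) j] a(1)[of k] \<open>0 \<le> c\<close>
            by (meson add_right_mono mult_left_mono mult_right_mono order_trans)
        qed
        also have "\<dots> = (c * M k + G) * step t k * a k" using k' by (simp add: doc_sum_1)
        also have "\<dots> \<le> (c * M k + G) * step t k * M i"
          using nn[OF k'(4)] \<open>0 \<le> c\<close> \<open>0 \<le> G\<close> M_ge[of k i] k' by (intro mult_left_mono mult_nonneg_nonneg add_nonneg_nonneg) auto
        finally show ?thesis by (simp add: algebra_simps)
      qed
      then have "(\<Sum>k=m..p. doc_sum t (\<lambda>j. F j k) k) \<le> (\<Sum>k=m..p. (c * (step t k * M k) + G * step t k) * M i)"
        by (rule sum_mono)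
      also have "\<dots> \<le> (\<Sum>k=m..i. (c * (step t k * M k) + G * step t k) * M i)"
        using nn p' Mpos \<open>0 \<le> c\<close> \<open>0 \<le> G\<close>
        by (intro sum_mono2) (auto intro!: mult_nonneg_nonneg add_nonneg_nonneg)
      also have "\<dots> = (c * (\<Sum>k=m..i. step t k * M k) + G * (\<Sum>k=m..i. step t k)) * M i"
        by (simp add: sum_distrib_left sum_distrib_right sum.distrib distrib_right)
      also have "\<dots> \<le> (c * (\<Sum>k=m..i. step t k * M k) + G * t n) * M i"
      proof -
        have "(\<Sum>k=m..i. step t k) \<le> t n"
          using sum_step[of m i] i m t_nonneg[of "m - 1"] t_mono[of i n] by force
        then show ?thesis using \<open>0 \<le> G\<close> Mpos by (intro mult_right_mono add_left_mono mult_left_mono) auto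
      qed
      finally have "(M i)\<^sup>2 \<le> (a (m - 1))\<^sup>2 + 2 * ((c * (\<Sum>k=m..i. step t k * M k) + G * t n) * M i)"
        using energy[OF p'(1)] p(2) by simp
      \<comment> \<open>The initial term must also carry a factor M i before that factor can be
        cancelled.\<close>
      moreover have "(a (m - 1))\<^sup>2 \<le> a (m - 1) * M i"
        unfolding power2_eq_square using M_ge[of "m - 1" i] i a(1) by (intro mult_left_mono) auto
      ultimately have "M i * M i \<le> (D + 2 * c * (\<Sum>k=m..i. step t k * M k)) * M i"
        by (simp add: D_def algebra_simps power2_eq_square)
      with Mpos show ?thesis by simp
    qed
  qed
  \<comment> \<open>Below m - 1 the maximum would be over an empty set; the value 0 there gives the
    nonnegativity at every index that the Gronwall lemma asks for.\<close>
  define x where "x i = (if m - 1 \<le> i then M i else 0)" for i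
  have "x n \<le> 2 * exp (4 * c * t (n - 1)) * D"
  proof (rule discrete_gronwall[where m=m])
    show "0 \<le> x i" for i using M_ge[of i i] a(1)[of i] by (auto simp: x_def intro: order_trans)
    show "x i \<le> D + 2 * c * (\<Sum>k=m..i. step t k * x k)" if "i \<in> {m..n}" for i
    proof -
      have "(\<Sum>k=m..i. step t k * x k) = (\<Sum>k=m..i. step t k * M k)" by (intro sum.cong) (auto simp: x_def)
      with M_bound[OF that] that show ?thesis by (auto simp: x_def)
    qed
  qed (use m \<open>0 \<le> c\<close> D small in auto)
  moreover have "m - 1 \<le> n" using m by simp
  ultimately have "M n \<le> 2 * exp (4 * c * t (n - 1)) * D" by (simp add: x_def)
  with M_ge[OF \<open>m - 1 \<le> n\<close> order_refl] show ?thesis by (simp add: D_def)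
qed

end

section \<open>Time derivatives and truncation errors\<close>

lemma L2_has_derivative_onD:
  assumes "L2_has_derivative_on \<Omega> I v v'" "s \<in> I"
  shows "v s \<in> L2 \<Omega>" "v' s \<in> L2 \<Omega>"
    and "((\<lambda>r. L2_norm \<Omega> (\<lambda>x. (v r x - v s x) / (r - s) - v' s x)) \<longlongrightarrow> 0) (at s within I)"
  using assms by (auto simp: L2_has_derivative_on_def)

lemma L2_difference_quotient:
  fixes v w :: "'a::euclidean_space \<Rightarrow> real"
  assumes "v \<in> L2 \<Omega>" "w \<in> L2 \<Omega>"
  shows "(\<lambda>x. (v x - w x) / c) \<in> L2 \<Omega>"
  using L2_cmult[OF L2_diff[OF assms], of "1 / c"] by simp

text \<open>By Cauchy-Schwarz the error of the scalar difference quotient is at most the error of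
  the \<open>L2\<close>-valued one times the norm of w.\<close>

lemma L2_has_derivative_inner:
  assumes v: "L2_has_derivative_on \<Omega> I v v'" and w: "w \<in> L2 \<Omega>" and s: "s \<in> I"
  shows "((\<lambda>r. L2_inner \<Omega> (v r) w) has_real_derivative L2_inner \<Omega> (v' s) w) (at s within I)"
proof -
  note D = L2_has_derivative_onD[OF v]
  have quot: "(L2_inner \<Omega> (v r) w - L2_inner \<Omega> (v s) w) / (r - s) - L2_inner \<Omega> (v' s) w =
      L2_inner \<Omega> (\<lambda>x. (v r x - v s x) / (r - s) - v' s x) w" if r: "r \<in> I" for r
  proof -
    have "L2_inner \<Omega> (\<lambda>x. (v r x - v s x) / (r - s) - v' s x) w =
        L2_inner \<Omega> (\<lambda>x. (1 / (r - s)) * (v r x - v s x)) w - L2_inner \<Omega> (v' s) w"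
      using L2_inner_diff_left[OF L2_difference_quotient[OF D(1)[OF r] D(1)[OF s]] D(2)[OF s] w] by simp
    also have "L2_inner \<Omega> (\<lambda>x. (1 / (r - s)) * (v r x - v s x)) w =
        (L2_inner \<Omega> (v r) w - L2_inner \<Omega> (v s) w) / (r - s)"
      unfolding L2_inner_cmult_left using L2_inner_diff_left[OF D(1)[OF r] D(1)[OF s] w] by simp
    finally show ?thesis by simp
  qed
  have "((\<lambda>r. (L2_inner \<Omega> (v r) w - L2_inner \<Omega> (v s) w) / (r - s) - L2_inner \<Omega> (v' s) w) \<longlongrightarrow> 0) (at s within I)"
  proof (rule Lim_null_comparison)
    show "\<forall>\<^sub>F r in at s within I. norm ((L2_inner \<Omega> (v r) w - L2_inner \<Omega> (v s) w) / (r - s) - L2_inner \<Omega> (v' s) w)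
        \<le> L2_norm \<Omega> (\<lambda>x. (v r x - v s x) / (r - s) - v' s x) * L2_norm \<Omega> w"
      unfolding eventually_at_filter
    proof (intro always_eventually allI impI)
      fix r assume r: "r \<in> I"
      show "norm ((L2_inner \<Omega> (v r) w - L2_inner \<Omega> (v s) w) / (r - s) - L2_inner \<Omega> (v' s) w)
        \<le> L2_norm \<Omega> (\<lambda>x. (v r x - v s x) / (r - s) - v' s x) * L2_norm \<Omega> w"
        unfolding quot[OF r] real_norm_def
        by (intro L2_inner_le_norm L2_diff L2_difference_quotient D r s w)
    qed
    show "((\<lambda>r. L2_norm \<Omega> (\<lambda>x. (v r x - v s x) / (r - s) - v' s x) * L2_norm \<Omega> w) \<longlongrightarrow> 0) (at s within I)"
      using tendsto_mult_right[OF D(3)[OF s], of "L2_norm \<Omega> w"] by simp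
  qed
  then show ?thesis unfolding has_field_derivative_iff by (subst LIM_zero_iff[symmetric])
qed

lemma L2_continuous_on_norm:
  assumes "L2_continuous_on \<Omega> I v"
  shows "continuous_on I (\<lambda>s. L2_norm \<Omega> (v s))"
  unfolding continuous_on_def
proof
  fix s assume s: "s \<in> I"
  have "((\<lambda>r. L2_norm \<Omega> (v r) - L2_norm \<Omega> (v s)) \<longlongrightarrow> 0) (at s within I)"
  proof (rule Lim_null_comparison)
    show "\<forall>\<^sub>F r in at s within I. norm (L2_norm \<Omega> (v r) - L2_norm \<Omega> (v s)) \<le> L2_norm \<Omega> (\<lambda>x. v r x - v s x)"
      unfolding eventually_at_filter real_norm_def
      using assms s by (intro always_eventually allI impI L2_norm_triangle_diff) (auto simp: L2_continuous_on_def)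
    show "((\<lambda>r. L2_norm \<Omega> (\<lambda>x. v r x - v s x)) \<longlongrightarrow> 0) (at s within I)"
      using assms s by (auto simp: L2_continuous_on_def)
  qed
  then show "((\<lambda>s. L2_norm \<Omega> (v s)) \<longlongrightarrow> L2_norm \<Omega> (v s)) (at s within I)"
    by (subst LIM_zero_iff[symmetric])
qed

lemma L2_has_derivative_imp_continuous:
  assumes v: "L2_has_derivative_on \<Omega> I v v'"
  shows "L2_continuous_on \<Omega> I v"
  unfolding L2_continuous_on_def
proof (intro conjI ballI)
  note D = L2_has_derivative_onD[OF v]
  fix s assume s: "s \<in> I"
  show "v s \<in> L2 \<Omega>" by (rule D(1)[OF s])
  let ?q = "\<lambda>r x. (v r x - v s x) / (r - s) - v' s x"
  show "((\<lambda>r. L2_norm \<Omega> (\<lambda>x. v r x - v s x)) \<longlongrightarrow> 0) (at s within I)"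
  proof (rule Lim_null_comparison)
    show "\<forall>\<^sub>F r in at s within I. norm (L2_norm \<Omega> (\<lambda>x. v r x - v s x)) \<le>
        \<bar>r - s\<bar> * (L2_norm \<Omega> (?q r) + L2_norm \<Omega> (v' s))"
      unfolding eventually_at_filter
    proof (intro always_eventually allI impI)
      fix r assume r: "r \<noteq> s" "r \<in> I"
      have "L2_norm \<Omega> (\<lambda>x. v r x - v s x) = L2_norm \<Omega> (\<lambda>x. (r - s) *\<^sub>R (?q r x + v' s x))"
        using r by simp
      also have "\<dots> = \<bar>r - s\<bar> * L2_norm \<Omega> (\<lambda>x. ?q r x + v' s x)"
        by (rule L2_norm_scale)
      also have "\<dots> \<le> \<bar>r - s\<bar> * (L2_norm \<Omega> (?q r) + L2_norm \<Omega> (v' s))"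
        by (intro mult_left_mono L2_norm_triangle L2_diff L2_difference_quotient D r s) simp
      finally show "norm (L2_norm \<Omega> (\<lambda>x. v r x - v s x)) \<le> \<bar>r - s\<bar> * (L2_norm \<Omega> (?q r) + L2_norm \<Omega> (v' s))"
        by (simp add: L2_norm_nonneg)
    qed
    have "((\<lambda>r. \<bar>r - s\<bar> * (L2_norm \<Omega> (?q r) + L2_norm \<Omega> (v' s))) \<longlongrightarrow> \<bar>s - s\<bar> * (0 + L2_norm \<Omega> (v' s))) (at s within I)"
      by (intro tendsto_intros D(3)[OF s])
    then show "((\<lambda>r. \<bar>r - s\<bar> * (L2_norm \<Omega> (?q r) + L2_norm \<Omega> (v' s))) \<longlongrightarrow> 0) (at s within I)"
      by simp
  qed
qed

text \<open>A remainder with Peano kernel k is presented as the increment of an explicit primitive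
  P. The fundamental theorem then delivers integrability of the product k h from differentiability
  alone, so that only the majorant g has to be continuous.\<close>

lemma weighted_increment_bound:
  fixes P h k g :: "real \<Rightarrow> real"
  assumes "a \<le> b"
    and P: "\<And>x. x \<in> {a..b} \<Longrightarrow> (P has_real_derivative k x * h x) (at x within {a..b})"
    and k: "\<And>x. x \<in> {a..b} \<Longrightarrow> \<bar>k x\<bar> \<le> C"
    and h: "\<And>x. x \<in> {a..b} \<Longrightarrow> \<bar>h x\<bar> \<le> g x"
    and g: "continuous_on {a..b} g"
  shows "\<bar>P b - P a\<bar> \<le> C * integral {a..b} g"
proof -
  have "((\<lambda>x. k x * h x) has_integral (P b - P a)) {a..b}"
    using assms(1) P by (intro fundamental_theorem_of_calculus)
      (auto simp: has_real_derivative_iff_has_vector_derivative[symmetric])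
  then have kh: "integral {a..b} (\<lambda>x. k x * h x) = P b - P a" "(\<lambda>x. k x * h x) integrable_on {a..b}"
    by (auto simp: has_integral_integral dest: integral_unique)
  have "norm (integral {a..b} (\<lambda>x. k x * h x)) \<le> integral {a..b} (\<lambda>x. C * g x)"
  proof (rule integral_norm_bound_integral[OF kh(2)])
    show "(\<lambda>x. C * g x) integrable_on {a..b}"
      using g by (intro integrable_continuous_real continuous_intros)
    show "norm (k x * h x) \<le> C * g x" if "x \<in> {a..b}" for x
      unfolding real_norm_def abs_mult
      by (intro mult_mono k h that order_trans[OF abs_ge_zero k[OF that]]) simp
  qed
  with kh(1) show ?thesis by simp
qed

text \<open>The function (x - a) \<phi>' - \<phi> is a primitive of (x - a) \<phi>'', and its
  increment is minus (b - a) times the truncation error. The kernel x - a is at most b - a, which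
  cancels the step.\<close>

lemma bdf1_consistency:
  fixes \<phi> \<phi>' \<phi>'' g :: "real \<Rightarrow> real"
  assumes "a < b" and "{a..b} \<subseteq> I"
    and d: "\<And>x. x \<in> I \<Longrightarrow> (\<phi> has_real_derivative \<phi>' x) (at x within I)"
      "\<And>x. x \<in> I \<Longrightarrow> (\<phi>' has_real_derivative \<phi>'' x) (at x within I)"
    and "\<And>x. x \<in> I \<Longrightarrow> \<bar>\<phi>'' x\<bar> \<le> g x" "continuous_on I g"
  shows "\<bar>(\<phi> b - \<phi> a) / (b - a) - \<phi>' b\<bar> \<le> integral {a..b} g"
proof -
  define P where "P x = (x - a) * \<phi>' x - \<phi> x" for x
  have "\<bar>P b - P a\<bar> \<le> (b - a) * integral {a..b} g"
  proof (rule weighted_increment_bound[where k="\<lambda>x. x - a" and h=\<phi>''])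
    fix x assume x: "x \<in> {a..b}"
    have "(P has_real_derivative (x - a) * \<phi>'' x) (at x within I)"
      unfolding P_def using x assms(2) by (auto intro!: derivative_eq_intros d)
    then show "(P has_real_derivative (x - a) * \<phi>'' x) (at x within {a..b})"
      using assms(2) by (rule DERIV_subset)
  qed (use assms in \<open>auto intro: continuous_on_subset\<close>)
  also have "P b - P a = - ((b - a) * ((\<phi> b - \<phi> a) / (b - a) - \<phi>' b))"
    using assms(1) by (simp add: P_def field_simps)
  finally show ?thesis using assms(1) by (simp add: abs_mult)
qed

context mesh
begin

text \<open>The coefficients of \<open>\<phi>''\<close> in \<open>P\<close> and \<open>R\<close> below are the two pieces of the Peano kernel of the BDF2
  formula; they agree to first order at \<open>t (n - 1)\<close>, so that the boundary terms there cancel.\<close>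

lemma bdf2_consistency:
  fixes \<phi> \<phi>' \<phi>'' \<phi>''' g :: "real \<Rightarrow> real"
  assumes n: "2 \<le> n" "n \<le> N"
    and d: "\<And>x. x \<in> {0..T} \<Longrightarrow> (\<phi> has_real_derivative \<phi>' x) (at x within {0..T})"
      "\<And>x. x \<in> {0..T} \<Longrightarrow> (\<phi>' has_real_derivative \<phi>'' x) (at x within {0..T})"
      "\<And>x. x \<in> {0..T} \<Longrightarrow> (\<phi>'' has_real_derivative \<phi>''' x) (at x within {0..T})"
    and g: "\<And>x. x \<in> {0..T} \<Longrightarrow> \<bar>\<phi>''' x\<bar> \<le> g x" "continuous_on {0..T} g"
  shows "\<bar>(\<Sum>k=1..n. bdf2_kernel t n (n - k) * (\<phi> (t k) - \<phi> (t (k - 1)))) - \<phi>' (t n)\<bar> \<le>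
    step t n / 2 * integral {t (n - 1)..t n} g + step t (n - 1) / 2 * integral {t (n - 1 - 1)..t (n - 1)} g"
proof -
  define c b a where "c = t n" and "b = t (n - 1)" and "a = t (n - 1 - 1)"
  define s q r where "s = step t n" and "q = step t (n - 1)" and "r = ratio t n"
  have s: "s > 0" "c - b = s" and q: "q > 0" "b - a = q" and r: "r > 0" "s = r * q"
  proof -
    have "1 \<le> n" "1 \<le> n - 1" "n - 1 \<le> N" using n by auto
    then show "s > 0" "c - b = s" "q > 0" "b - a = q" "r > 0" "s = r * q"
      using n step_pos[of n] step_pos[of "n - 1"] ratio_pos[of n]
      by (simp_all add: s_def q_def r_def a_def b_def c_def ratio_def step_def)
  qed
  define \<beta>0 \<beta>1 where "\<beta>0 = bdf2_kernel t n 0" and "\<beta>1 = bdf2_kernel t n 1"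
  have \<beta>0: "\<beta>0 * s = (1 + 2 * r) / (1 + r)" and \<beta>1: "\<beta>1 * s = - (r\<^sup>2 / (1 + r))"
    using n s(1) by (auto simp: \<beta>0_def \<beta>1_def bdf2_kernel_def simp flip: s_def r_def)
  have \<beta>0s: "1 \<le> \<beta>0 * s" "\<beta>0 * s \<le> 2" using r(1) by (auto simp: \<beta>0 field_simps)
  have \<beta>1q: "\<beta>1 * q = - (r / (1 + r))"
  proof -
    have "r * (\<beta>1 * q) = r * (- (r / (1 + r)))" using \<beta>1 r by (simp add: mult_ac power2_eq_square)
    with r(1) show ?thesis by (metis mult_left_cancel order_less_irrefl)
  qed
  \<comment> \<open>This is exactness of the formula for linear functions, and \<open>match0\<close>
    is exactness for (x - b)^2 / 2; they equate the slopes and the values of the two kernel pieces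
    at b.\<close>
  have match1: "1 - \<beta>0 * s = \<beta>1 * q" using r(1) by (simp add: \<beta>0 \<beta>1q field_simps)
  have match0: "- s + \<beta>0 * s\<^sup>2 / 2 = \<beta>1 * q\<^sup>2 / 2"
  proof -
    have "- s + \<beta>0 * s\<^sup>2 / 2 = s * ((\<beta>0 * s) / 2 - 1)" by (simp add: algebra_simps power2_eq_square)
    also have "\<dots> = r * q * ((1 + 2 * r) / (1 + r) / 2 - 1)" unfolding \<beta>0 by (simp only: r(2))
    also have "\<dots> = q * (- (r / (1 + r))) / 2" using r(1) by (simp add: field_simps)
    also have "\<dots> = \<beta>1 * q\<^sup>2 / 2" by (simp flip: \<beta>1q add: power2_eq_square)
    finally show ?thesis .
  qed
  have abc: "0 \<le> a" "c \<le> T" "a < b" "b < c"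
    using t_nonneg[of "n - 1 - 1"] t_le_T[of n] n s q by (auto simp: a_def c_def)
  define P where "P x = (- (c - x) + \<beta>0 * (c - x)\<^sup>2 / 2) * \<phi>'' x - (1 - \<beta>0 * (c - x)) * \<phi>' x + \<beta>0 * \<phi> x" for x
  define R where "R x = (\<beta>1 * (x - a)\<^sup>2 / 2) * \<phi>'' x - (\<beta>1 * (x - a)) * \<phi>' x + \<beta>1 * \<phi> x" for x
  have P: "\<bar>P c - P b\<bar> \<le> s / 2 * integral {b..c} g"
  proof (rule weighted_increment_bound[where k="\<lambda>x. - (c - x) + \<beta>0 * (c - x)\<^sup>2 / 2" and h=\<phi>'''])
    fix x assume x: "x \<in> {b..c}"
    then have xT: "x \<in> {0..T}" using abc by auto
    have "(P has_real_derivative (- (c - x) + \<beta>0 * (c - x)\<^sup>2 / 2) * \<phi>''' x) (at x within {0..T})"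
      unfolding P_def
      by (auto intro!: derivative_eq_intros d xT) (simp add: algebra_simps)
    then show "(P has_real_derivative (- (c - x) + \<beta>0 * (c - x)\<^sup>2 / 2) * \<phi>''' x) (at x within {b..c})"
      by (rule DERIV_subset) (use abc in auto)
    \<comment> \<open>On this piece the kernel is -\<sigma> + \<beta>0 \<sigma>^2 / 2. It is at most
      0 because \<beta>0 s <= 2. Because \<beta>0 s >= 1 it is at least -\<sigma> + \<sigma>^2 / (2
      s), hence at least -s / 2.\<close>
    define \<sigma> where "\<sigma> = c - x"
    have \<sigma>: "0 \<le> \<sigma>" "\<sigma> \<le> s" using x s by (auto simp: \<sigma>_def)
    have "\<beta>0 \<ge> 0" using \<beta>0s s(1) by (smt (verit) mult_neg_pos)
    then have "\<beta>0 * \<sigma> \<le> 2" using mult_left_mono[OF \<sigma>(2), of \<beta>0] \<beta>0s by linarith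
    then have up: "\<beta>0 * \<sigma> * \<sigma> \<le> 2 * \<sigma>" using \<sigma> by (intro mult_right_mono)
    have "2 * \<sigma> * s \<le> \<sigma>\<^sup>2 + s\<^sup>2" by (rule sum_squares_bound)
    also have "\<dots> \<le> \<beta>0 * s * \<sigma>\<^sup>2 + s\<^sup>2" using mult_right_mono[OF \<beta>0s(1), of "\<sigma>\<^sup>2"] by simp
    finally have "s * (2 * \<sigma>) \<le> s * (\<beta>0 * \<sigma> * \<sigma> + s)" by (simp add: algebra_simps power2_eq_square)
    then have lo: "2 * \<sigma> \<le> \<beta>0 * \<sigma> * \<sigma> + s" using s(1) by simp
    show "\<bar>- (c - x) + \<beta>0 * (c - x)\<^sup>2 / 2\<bar> \<le> s / 2"
      using up lo s(1) unfolding \<sigma>_def[symmetric] power2_eq_square by (simp add: abs_le_iff mult.assoc)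
  qed (use abc g in \<open>auto intro: continuous_on_subset\<close>)
  have R: "\<bar>R b - R a\<bar> \<le> q / 2 * integral {a..b} g"
  proof (rule weighted_increment_bound[where k="\<lambda>x. \<beta>1 * (x - a)\<^sup>2 / 2" and h=\<phi>'''])
    fix x assume x: "x \<in> {a..b}"
    then have xT: "x \<in> {0..T}" using abc by auto
    have "(R has_real_derivative (\<beta>1 * (x - a)\<^sup>2 / 2) * \<phi>''' x) (at x within {0..T})"
      unfolding R_def
      by (auto intro!: derivative_eq_intros d xT) (simp add: field_simps)
    then show "(R has_real_derivative (\<beta>1 * (x - a)\<^sup>2 / 2) * \<phi>''' x) (at x within {a..b})"
      by (rule DERIV_subset) (use abc in auto)
    \<comment> \<open>The bound q / 2 rests on |\<beta>1 q| = r / (1 + r) <= 1, which holds for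
      every step ratio.\<close>
    have "(x - a)\<^sup>2 \<le> q\<^sup>2" using x q by (intro power_mono) auto
    then have "\<bar>\<beta>1\<bar> * (x - a)\<^sup>2 \<le> \<bar>\<beta>1\<bar> * q\<^sup>2" by (intro mult_left_mono) auto
    also have "\<dots> = \<bar>\<beta>1 * q\<bar> * q" using q(1) by (simp add: abs_mult power2_eq_square)
    also have "\<dots> \<le> 1 * q" using q(1) r(1) by (intro mult_right_mono) (auto simp: \<beta>1q field_simps)
    finally show "\<bar>\<beta>1 * (x - a)\<^sup>2 / 2\<bar> \<le> q / 2" by (simp add: abs_mult)
  qed (use abc g in \<open>auto intro: continuous_on_subset\<close>)
  have Pb: "P b = (\<beta>1 * q\<^sup>2 / 2) * \<phi>'' b - (\<beta>1 * q) * \<phi>' b + \<beta>0 * \<phi> b"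
    unfolding P_def s(2) match0 match1 ..
  have "(P c - P b) + (R b - R a) = \<beta>0 * (\<phi> c - \<phi> b) + \<beta>1 * (\<phi> b - \<phi> a) - \<phi>' c"
    unfolding Pb by (simp add: P_def R_def q(2) algebra_simps)
  moreover have "(\<Sum>k=1..n. bdf2_kernel t n (n - k) * (\<phi> (t k) - \<phi> (t (k - 1)))) =
      \<beta>0 * (\<phi> c - \<phi> b) + \<beta>1 * (\<phi> b - \<phi> a)"
    using n by (subst sum_bdf2_kernel) (auto simp: \<beta>0_def \<beta>1_def a_def b_def c_def)
  ultimately show ?thesis
    using P R unfolding a_def b_def c_def s_def q_def by linarith
qed

end

section \<open>The error estimate\<close>

text \<open>Completeness of Lebesgue measure transfers measurability across a null set. This places
  \<open>u0\<close>, known only through almost everywhere equality with \<open>u 0\<close>, in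
  \<open>L2\<close>.\<close>

lemma L2_cong_AE:
  fixes v v' :: "'a::euclidean_space \<Rightarrow> 'b::euclidean_space"
  assumes \<Omega>: "\<Omega> \<in> sets lebesgue" and v: "v \<in> L2 \<Omega>" and eq: "AE x in lebesgue_on \<Omega>. v x = v' x"
  shows "v' \<in> L2 \<Omega>"
proof -
  have "AE x in lebesgue. x \<in> \<Omega> \<longrightarrow> v x = v' x" using eq \<Omega> by (simp add: AE_restrict_space_iff)
  then obtain Z where Z: "{x. \<not> (x \<in> \<Omega> \<longrightarrow> v x = v' x)} \<subseteq> Z" "Z \<in> null_sets lebesgue"
    by (auto simp: eventually_ae_filter)
  have "v measurable_on \<Omega>" using v \<Omega> by (simp add: L2_def measurable_on_iff_borel_measurable)
  then have "v' measurable_on \<Omega>"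
    by (rule measurable_on_spike[where S=Z]) (use Z in \<open>auto simp: negligible_iff_null_sets\<close>)
  then have m: "v' \<in> borel_measurable (lebesgue_on \<Omega>)" using \<Omega> by (simp add: measurable_on_iff_borel_measurable)
  have "integrable (lebesgue_on \<Omega>) (\<lambda>x. (norm (v' x))\<^sup>2)"
  proof (rule integrable_cong_AE_imp)
    show "integrable (lebesgue_on \<Omega>) (\<lambda>x. (norm (v x))\<^sup>2)" using v by (simp add: L2_def)
    show "AE x in lebesgue_on \<Omega>. (norm (v x))\<^sup>2 = (norm (v' x))\<^sup>2" using eq by eventually_elim simp
  qed (use m in measurable)
  with m show ?thesis by (simp add: L2_def)
qed

lemma L2_norm_bounded_mult:
  fixes k v :: "'a::euclidean_space \<Rightarrow> real"
  assumes "v \<in> L2 \<Omega>" "k \<in> borel_measurable (lebesgue_on \<Omega>)" "\<forall>x\<in>\<Omega>. \<bar>k x\<bar> \<le> C" "0 \<le> C"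
  shows "L2_norm \<Omega> (\<lambda>x. k x * v x) \<le> C * L2_norm \<Omega> v"
proof -
  have kv: "(\<lambda>x. k x * v x) \<in> L2 \<Omega>" using assms by (intro L2_bounded_mult)
  have Cv: "(\<lambda>x. C * v x) \<in> L2 \<Omega>" using assms by (intro L2_cmult)
  have "L2_inner \<Omega> (\<lambda>x. k x * v x) (\<lambda>x. k x * v x) \<le> L2_inner \<Omega> (\<lambda>x. C * v x) (\<lambda>x. C * v x)"
    unfolding L2_inner_def
  proof (intro integral_mono L2_integrable_inner kv Cv)
    fix x assume "x \<in> space (lebesgue_on \<Omega>)"
    then have "\<bar>k x\<bar> \<le> \<bar>C\<bar>" using assms(3,4) by auto
    then have "\<bar>k x * v x\<bar> \<le> \<bar>C * v x\<bar>" unfolding abs_mult by (rule mult_right_mono) simp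
    then show "(k x * v x) \<bullet> (k x * v x) \<le> (C * v x) \<bullet> (C * v x)"
      by (simp add: power2_eq_square[symmetric] abs_le_square_iff)
  qed
  then have "L2_norm \<Omega> (\<lambda>x. k x * v x) \<le> L2_norm \<Omega> (\<lambda>x. C * v x)"
    unfolding L2_norm_def by (rule real_sqrt_le_mono)
  also have "\<dots> = C * L2_norm \<Omega> v" using L2_norm_scale[of \<Omega> C v] assms(4) by simp
  finally show ?thesis .
qed

lemma D2_L2:
  assumes "\<And>k. k \<le> n \<Longrightarrow> v k \<in> L2 \<Omega>"
  shows "D2 t v n \<in> L2 \<Omega>"
  unfolding D2_def[abs_def] using assms by (intro L2_sum L2_cmult L2_diff) auto

lemma L2_inner_D2:
  assumes "\<And>k. k \<le> n \<Longrightarrow> v k \<in> L2 \<Omega>" "w \<in> L2 \<Omega>"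
  shows "L2_inner \<Omega> (D2 t v n) w =
    (\<Sum>k=1..n. bdf2_kernel t n (n - k) * (L2_inner \<Omega> (v k) w - L2_inner \<Omega> (v (k - 1)) w))"
  unfolding D2_def[abs_def] using assms
  by (subst L2_inner_sum_left) (auto simp: L2_inner_cmult_left L2_inner_diff_left intro!: L2_cmult L2_diff sum.cong)

section \<open>Positivity of the diffusion term and the error equation\<close>

context mesh
begin

text \<open>The form splits over an orthonormal basis into scalar forms.\<close>

lemma doc_sum_inner_psd:
  fixes E :: "nat \<Rightarrow> 'b::euclidean_space"
  assumes psd: "bdf2_kernels_psd N t" and "n \<le> N"
  shows "0 \<le> (\<Sum>k=1..n. doc_sum t (\<lambda>j. E j \<bullet> E k) k)"
proof -
  have "(\<Sum>k=1..n. doc_sum t (\<lambda>j. E j \<bullet> E k) k) =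
      (\<Sum>k=1..n. \<Sum>b\<in>Basis. (E k \<bullet> b) * doc_sum t (\<lambda>j. E j \<bullet> b) k)"
  proof (intro sum.cong refl)
    fix k
    have "doc_sum t (\<lambda>j. E j \<bullet> E k) k = (\<Sum>j=1..k. \<Sum>b\<in>Basis. (E k \<bullet> b) * (doc_kernel t k j * (E j \<bullet> b)))"
      unfolding doc_sum_def by (subst euclidean_inner) (simp add: sum_distrib_left mult_ac)
    also have "\<dots> = (\<Sum>b\<in>Basis. (E k \<bullet> b) * doc_sum t (\<lambda>j. E j \<bullet> b) k)"
      unfolding doc_sum_def by (subst sum.swap) (simp add: sum_distrib_left)
    finally show "doc_sum t (\<lambda>j. E j \<bullet> E k) k = (\<Sum>b\<in>Basis. (E k \<bullet> b) * doc_sum t (\<lambda>j. E j \<bullet> b) k)" .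
  qed
  also have "\<dots> = (\<Sum>b\<in>Basis. \<Sum>k=1..n. (E k \<bullet> b) * doc_sum t (\<lambda>j. E j \<bullet> b) k)"
    by (rule sum.swap)
  also have "\<dots> \<ge> 0"
    using assms by (intro sum_nonneg doc_sum_psd)
  finally show ?thesis .
qed

text \<open>At each point x the vectors E j x give a nonnegative form, and integration preserves the
  sign. In the application the E j are errors of gradients.\<close>

lemma doc_sum_L2_inner_psd:
  fixes E :: "nat \<Rightarrow> 'a::euclidean_space \<Rightarrow> 'b::euclidean_space"
  assumes psd: "bdf2_kernels_psd N t" and "n \<le> N" and E: "\<And>j. j \<le> n \<Longrightarrow> E j \<in> L2 \<Omega>"
  shows "0 \<le> (\<Sum>k=1..n. doc_sum t (\<lambda>j. L2_inner \<Omega> (E j) (E k)) k)"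
proof -
  have int: "integrable (lebesgue_on \<Omega>) (\<lambda>x. E j x \<bullet> E k x)" if "j \<le> n" "k \<le> n" for j k
    by (intro L2_integrable_inner E that)
  have "(\<Sum>k=1..n. doc_sum t (\<lambda>j. L2_inner \<Omega> (E j) (E k)) k) =
      (LINT x|lebesgue_on \<Omega>. (\<Sum>k=1..n. doc_sum t (\<lambda>j. E j x \<bullet> E k x) k))"
    unfolding doc_sum_def L2_inner_def
    by (subst Bochner_Integration.integral_sum, force intro!: Bochner_Integration.integrable_sum int,
        intro sum.cong refl, subst Bochner_Integration.integral_sum) (auto intro!: int)
  also have "\<dots> \<ge> 0"
    using doc_sum_inner_psd[OF psd \<open>n \<le> N\<close>] by (intro Bochner_Integration.integral_nonneg)
  finally show ?thesis .
qed

text \<open>Both starting procedures are covered by m, the first level with a variational equation.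
  The number G bounds the truncation error from level m on and, below m, the norm of
  \<open>D2\<close> of the error, which acts there as a source.\<close>

lemma error_bound:
  fixes \<Omega> :: "'a::euclidean_space set" and u :: "real \<Rightarrow> 'a \<Rightarrow> real"
  assumes \<Omega>: "open \<Omega>" "bounded \<Omega>" and "\<epsilon> > 0"
    and \<kappa>: "continuous_on \<Omega> \<kappa>" "\<kappa>s > 0" "\<forall>x\<in>\<Omega>. \<bar>\<kappa> x\<bar> \<le> \<kappa>s"
    and f: "\<forall>s\<in>{0..T}. f s \<in> L2 \<Omega>"
    and u: "diffusion_solution \<Omega> \<epsilon> \<kappa> T f u0 u ut utt uttt"
    and psd: "bdf2_kernels_psd N t"
    and small: "\<forall>k\<in>{1..N}. step t k \<le> 1 / (4 * \<kappa>s)"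
    and U: "adaptive_bdf2 m \<Omega> \<epsilon> \<kappa> f N t U"
    and m: "1 \<le> m" "m \<le> n" "n \<le> N" and "0 \<le> G"
    and start: "\<And>j. 1 \<le> j \<Longrightarrow> j < m \<Longrightarrow> L2_norm \<Omega> (D2 t (\<lambda>k x. u (t k) x - U k x) j) \<le> G"
    and consistency: "\<And>j w. j \<in> {m..n} \<Longrightarrow> w \<in> L2 \<Omega> \<Longrightarrow>
      \<bar>(\<Sum>i=1..j. bdf2_kernel t j (j - i) * (L2_inner \<Omega> (u (t i)) w - L2_inner \<Omega> (u (t (i - 1))) w))
        - L2_inner \<Omega> (ut (t j)) w\<bar> \<le> G * L2_norm \<Omega> w"
  shows "L2_norm \<Omega> (\<lambda>x. u (t n) x - U n x) \<le>
    2 * exp (4 * \<kappa>s * t (n - 1)) * (L2_norm \<Omega> (\<lambda>x. u (t (m - 1)) x - U (m - 1) x) + 2 * t n * G)"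
proof -
  define e where "e k x = u (t k) x - U k x" for k x
  \<comment> \<open>Below m the numerical solution is only known to lie in \<open>L2\<close>. The
    value zero there lets the diffusion form start at level 1, where positive semi-definiteness
    applies.\<close>
  define E where "E k x = (if k < m then 0 else weak_grad \<Omega> (u (t k)) x - weak_grad \<Omega> (U k) x)" for k x
  have tT: "t k \<in> {0..T}" if "k \<le> n" for k
    using t_nonneg[of k] t_le_T[of k] that m by auto
  have uH10: "u (t k) \<in> H10 \<Omega>" and uH2: "u (t k) \<in> H2 \<Omega>" and utL: "ut (t k) \<in> L2 \<Omega>"
    if "k \<le> n" for k
    using u tT[OF that] by (auto simp: diffusion_solution_def H2_continuous_on_def L2_has_derivative_on_def)
  have UH10: "U k \<in> H10 \<Omega>" if "k \<in> {m..n}" for k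
    using U that m by (auto simp: adaptive_bdf2_def)
  have uL: "u (t k) \<in> L2 \<Omega>" "weak_grad \<Omega> (u (t k)) \<in> L2 \<Omega>" if "k \<le> n" for k
    using H1_L2[OF H10_H1[OF uH10[OF that]]] by auto
  have UL: "U k \<in> L2 \<Omega>" if "k \<le> n" for k
    using U H1_L2(1)[OF H10_H1[OF UH10[of k]]] that by (cases "k < m") (auto simp: adaptive_bdf2_def)
  have gUL: "weak_grad \<Omega> (U k) \<in> L2 \<Omega>" if "k \<in> {m..n}" for k
    by (rule H1_L2(2)[OF H10_H1[OF UH10[OF that]]])
  have eL: "e k \<in> L2 \<Omega>" if "k \<le> n" for k
    unfolding e_def[abs_def] by (intro L2_diff uL UL that)
  have E_eq: "E k = (\<lambda>x. weak_grad \<Omega> (u (t k)) x - weak_grad \<Omega> (U k) x)" if "m \<le> k" for k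
    using that by (auto simp: E_def)
  have EL: "E k \<in> L2 \<Omega>" if "k \<le> n" for k
  proof (cases "k < m")
    case True
    then have "E k = (\<lambda>x. 0)" by (auto simp: E_def)
    then show ?thesis by (simp add: L2_zero)
  next
    case False
    then show ?thesis using that uL(2)[of k] gUL[of k] by (auto simp: E_eq intro!: L2_diff)
  qed
  have \<kappa>m: "\<kappa> \<in> borel_measurable (lebesgue_on \<Omega>)"
    using \<kappa>(1) \<Omega> by (intro continuous_imp_measurable_on_sets_lebesgue) auto
  have \<kappa>L: "(\<lambda>x. \<kappa> x * v x) \<in> L2 \<Omega>" if "v \<in> L2 \<Omega>" for v
    by (rule L2_bounded_mult[OF that \<kappa>m \<kappa>(3)])
  \<comment> \<open>The truncation error is kept as a linear functional of the test
    function.\<close>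
  define \<eta> where "\<eta> j w = (\<Sum>i=1..j. bdf2_kernel t j (j - i) * (L2_inner \<Omega> (u (t i)) w - L2_inner \<Omega> (u (t (i - 1))) w))
        - L2_inner \<Omega> (ut (t j)) w" for j w
  have weak: "L2_inner \<Omega> (D2 t e j) w + \<epsilon> * L2_inner \<Omega> (E j) (weak_grad \<Omega> w) =
      L2_inner \<Omega> (\<lambda>x. \<kappa> x * e j x) w + \<eta> j w" if j: "j \<in> {m..n}" and w: "w \<in> H10 \<Omega>" for j w
  proof -
    have jn: "j \<le> n" "t j \<in> {0<..T}" using j m tT[of j] t_strict_mono[of 0 j] by auto
    have wL: "w \<in> L2 \<Omega>" "weak_grad \<Omega> w \<in> L2 \<Omega>" using H1_L2[OF H10_H1[OF w]] by auto
    have scheme: "L2_inner \<Omega> (D2 t U j) w + \<epsilon> * L2_inner \<Omega> (weak_grad \<Omega> (U j)) (weak_grad \<Omega> w) =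
        L2_inner \<Omega> (\<lambda>x. \<kappa> x * U j x) w + L2_inner \<Omega> (f (t j)) w"
      using U j w m by (auto simp: adaptive_bdf2_def)
    have AE: "AE x in lebesgue_on \<Omega>. ut (t j) x - \<epsilon> * weak_laplacian \<Omega> (u (t j)) x = \<kappa> x * u (t j) x + f (t j) x"
      using u jn by (auto simp: diffusion_solution_def)
    have lap: "weak_laplacian \<Omega> (u (t j)) \<in> L2 \<Omega>" by (rule weak_laplacian_L2[OF uH2[OF jn(1)]])
    have fL: "f (t j) \<in> L2 \<Omega>" by (rule f[rule_format, OF tT[OF jn(1)]])
    have "L2_inner \<Omega> (\<lambda>x. ut (t j) x - \<epsilon> * weak_laplacian \<Omega> (u (t j)) x) w =
        L2_inner \<Omega> (\<lambda>x. \<kappa> x * u (t j) x + f (t j) x) w"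
      by (intro L2_inner_cong_AE AE wL L2_diff L2_add L2_cmult \<kappa>L utL uL fL lap jn)
    then have "L2_inner \<Omega> (ut (t j)) w + \<epsilon> * L2_inner \<Omega> (weak_grad \<Omega> (u (t j))) (weak_grad \<Omega> w) =
        L2_inner \<Omega> (\<lambda>x. \<kappa> x * u (t j) x) w + L2_inner \<Omega> (f (t j)) w"
      using Green_H10[OF \<Omega> uH2[OF jn(1)] w]
      by (simp add: L2_inner_diff_left L2_inner_add_left L2_inner_cmult_left L2_cmult \<kappa>L utL uL fL lap jn wL)
    moreover have "\<epsilon> * L2_inner \<Omega> (E j) (weak_grad \<Omega> w) =
        \<epsilon> * L2_inner \<Omega> (weak_grad \<Omega> (u (t j))) (weak_grad \<Omega> w) - \<epsilon> * L2_inner \<Omega> (weak_grad \<Omega> (U j)) (weak_grad \<Omega> w)"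
      using j by (simp add: E_eq L2_inner_diff_left uL gUL wL right_diff_distrib)
    moreover have "L2_inner \<Omega> (\<lambda>x. \<kappa> x * e j x) w = L2_inner \<Omega> (\<lambda>x. \<kappa> x * u (t j) x) w - L2_inner \<Omega> (\<lambda>x. \<kappa> x * U j x) w"
      using jn by (simp add: e_def right_diff_distrib L2_inner_diff_left \<kappa>L uL UL wL)
    moreover have "L2_inner \<Omega> (D2 t e j) w =
        (\<Sum>i=1..j. bdf2_kernel t j (j - i) * (L2_inner \<Omega> (u (t i)) w - L2_inner \<Omega> (u (t (i - 1))) w)) - L2_inner \<Omega> (D2 t U j) w"
    proof -
      have "L2_inner \<Omega> (e i) w = L2_inner \<Omega> (u (t i)) w - L2_inner \<Omega> (U i) w" if "i \<le> n" for i
        unfolding e_def[abs_def] by (intro L2_inner_diff_left uL UL wL that)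
      note e_inner = this
      have "(\<Sum>i=1..j. bdf2_kernel t j (j - i) * (L2_inner \<Omega> (e i) w - L2_inner \<Omega> (e (i - 1)) w)) =
          (\<Sum>i=1..j. bdf2_kernel t j (j - i) * (L2_inner \<Omega> (u (t i)) w - L2_inner \<Omega> (u (t (i - 1))) w)
            - bdf2_kernel t j (j - i) * (L2_inner \<Omega> (U i) w - L2_inner \<Omega> (U (i - 1)) w))"
      proof (intro sum.cong refl)
        fix i assume "i \<in> {1..j}"
        then have "i \<le> n" "i - 1 \<le> n" using jn by auto
        from e_inner[OF this(1)] e_inner[OF this(2)]
        show "bdf2_kernel t j (j - i) * (L2_inner \<Omega> (e i) w - L2_inner \<Omega> (e (i - 1)) w) =
            bdf2_kernel t j (j - i) * (L2_inner \<Omega> (u (t i)) w - L2_inner \<Omega> (u (t (i - 1))) w)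
            - bdf2_kernel t j (j - i) * (L2_inner \<Omega> (U i) w - L2_inner \<Omega> (U (i - 1)) w)"
          by (simp only:) (simp add: algebra_simps)
      qed
      then show ?thesis
        using jn wL eL UL by (simp add: L2_inner_D2 sum_subtractf)
    qed
    ultimately show ?thesis using scheme unfolding \<eta>_def by linarith
  qed
  have weak_e: "L2_inner \<Omega> (D2 t e j) (e k) + \<epsilon> * L2_inner \<Omega> (E j) (E k) =
      L2_inner \<Omega> (\<lambda>x. \<kappa> x * e j x) (e k) + \<eta> j (e k)" if j: "j \<in> {m..n}" and k: "k \<in> {m..n}" for j k
  proof -
    have jk: "j \<le> n" "k \<le> n" using j k by auto
    have diff: "L2_inner \<Omega> z (e k) = L2_inner \<Omega> z (u (t k)) - L2_inner \<Omega> z (U k)" if "z \<in> L2 \<Omega>" for z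
      unfolding e_def[abs_def] by (intro L2_inner_diff_right uL UL jk that)
    have "(\<Sum>i=1..j. bdf2_kernel t j (j - i) * (L2_inner \<Omega> (u (t i)) (e k) - L2_inner \<Omega> (u (t (i - 1))) (e k))) =
        (\<Sum>i=1..j. bdf2_kernel t j (j - i) * (L2_inner \<Omega> (u (t i)) (u (t k)) - L2_inner \<Omega> (u (t (i - 1))) (u (t k)))
          - bdf2_kernel t j (j - i) * (L2_inner \<Omega> (u (t i)) (U k) - L2_inner \<Omega> (u (t (i - 1))) (U k)))"
    proof (intro sum.cong refl)
      fix i assume "i \<in> {1..j}"
      then have "i \<le> n" "i - 1 \<le> n" using jk by auto
      from diff[OF uL(1)[OF this(1)]] diff[OF uL(1)[OF this(2)]]
      show "bdf2_kernel t j (j - i) * (L2_inner \<Omega> (u (t i)) (e k) - L2_inner \<Omega> (u (t (i - 1))) (e k)) =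
          bdf2_kernel t j (j - i) * (L2_inner \<Omega> (u (t i)) (u (t k)) - L2_inner \<Omega> (u (t (i - 1))) (u (t k)))
          - bdf2_kernel t j (j - i) * (L2_inner \<Omega> (u (t i)) (U k) - L2_inner \<Omega> (u (t (i - 1))) (U k))"
        by (simp only:) (simp add: algebra_simps)
    qed
    then have "\<eta> j (e k) = \<eta> j (u (t k)) - \<eta> j (U k)"
      unfolding \<eta>_def diff[OF utL[OF jk(1)]] by (simp add: sum_subtractf)
    moreover have "L2_inner \<Omega> (E j) (E k) = L2_inner \<Omega> (E j) (weak_grad \<Omega> (u (t k))) - L2_inner \<Omega> (E j) (weak_grad \<Omega> (U k))"
      using k by (subst (2) E_eq) (auto intro!: L2_inner_diff_right uL gUL EL jk)
    then have "\<epsilon> * L2_inner \<Omega> (E j) (E k) =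
        \<epsilon> * L2_inner \<Omega> (E j) (weak_grad \<Omega> (u (t k))) - \<epsilon> * L2_inner \<Omega> (E j) (weak_grad \<Omega> (U k))"
      by (simp add: right_diff_distrib)
    moreover have D: "D2 t e j \<in> L2 \<Omega>" using jk by (intro D2_L2 eL) auto
    moreover have K: "(\<lambda>x. \<kappa> x * e j x) \<in> L2 \<Omega>" by (intro \<kappa>L eL jk)
    ultimately show ?thesis
      using weak[OF j uH10[OF jk(2)]] weak[OF j UH10[OF k]] diff[OF D] diff[OF K] by linarith
  qed
  \<comment> \<open>Below level m the tautology that \<open>D2\<close> of the error equals itself
    takes the place of the scheme: the diffusion part vanishes and F absorbs the rest.\<close>
  define Q where "Q j k = \<epsilon> * L2_inner \<Omega> (E j) (E k)" for j k
  define F where "F j k = (if j < m then L2_inner \<Omega> (D2 t e j) (e k)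
    else L2_inner \<Omega> (\<lambda>x. \<kappa> x * e j x) (e k) + \<eta> j (e k))" for j k
  have E0: "E k = (\<lambda>x. 0)" if "k < m" for k using that by (auto simp: E_def)
  have "L2_norm \<Omega> (e n) \<le> 2 * exp (4 * \<kappa>s * t (n - 1)) * (L2_norm \<Omega> (e (m - 1)) + 2 * t n * G)"
  proof (rule bdf2_stability[where A="\<lambda>i k. L2_inner \<Omega> (e i) (e k)" and Q=Q and F=F and a="\<lambda>k. L2_norm \<Omega> (e k)"])
    show "\<kappa>s * step t k \<le> 1 / 4" if "k \<in> {m..n}" for k
      using bspec[OF small, of k] that m \<kappa>(2) by (auto simp: field_simps)
    show "L2_inner \<Omega> (e i) (e k) \<le> L2_norm \<Omega> (e i) * L2_norm \<Omega> (e k)" if "i \<le> n" "k \<le> n" for i k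
      using L2_inner_le_norm[OF eL[OF that(1)] eL[OF that(2)]] by simp
    show "0 \<le> (\<Sum>k=m..i. doc_sum t (\<lambda>j. Q j k) k)" if i: "i \<in> {m..n}" for i
    proof -
      have "(\<Sum>k=m..i. doc_sum t (\<lambda>j. Q j k) k) = (\<Sum>k=1..i. doc_sum t (\<lambda>j. Q j k) k)"
        using m by (intro sum.mono_neutral_left) (auto simp: Q_def E0 L2_inner_def doc_sum_def)
      also have "\<dots> = \<epsilon> * (\<Sum>k=1..i. doc_sum t (\<lambda>j. L2_inner \<Omega> (E j) (E k)) k)"
        by (simp add: Q_def doc_sum_cmult sum_distrib_left)
      also have "\<dots> \<ge> 0"
        using i m \<open>\<epsilon> > 0\<close> by (intro mult_nonneg_nonneg doc_sum_L2_inner_psd psd EL) auto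
      finally show ?thesis .
    qed
    show "(\<Sum>i=1..j. bdf2_kernel t j (j - i) * (L2_inner \<Omega> (e i) (e k) - L2_inner \<Omega> (e (i - 1)) (e k))) + Q j k = F j k"
      if k: "k \<in> {m..n}" and j: "j \<in> {1..k}" for j k
    proof -
      have "(\<Sum>i=1..j. bdf2_kernel t j (j - i) * (L2_inner \<Omega> (e i) (e k) - L2_inner \<Omega> (e (i - 1)) (e k))) = L2_inner \<Omega> (D2 t e j) (e k)"
        using k j by (intro L2_inner_D2[symmetric] eL) auto
      moreover have "j \<in> {m..n}" if "\<not> j < m" using that j k by auto
      ultimately show ?thesis
        using weak_e[of j k] k by (cases "j < m") (auto simp: F_def Q_def E0 L2_inner_def)
    qed
    show "F j k \<le> (\<kappa>s * (if m \<le> j then L2_norm \<Omega> (e j) else 0) + G) * L2_norm \<Omega> (e k)"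
      if k: "k \<in> {m..n}" and j: "j \<in> {1..k}" for j k
    proof (cases "j < m")
      case True
      have "L2_inner \<Omega> (D2 t e j) (e k) \<le> L2_norm \<Omega> (D2 t e j) * L2_norm \<Omega> (e k)"
        using L2_inner_le_norm[OF D2_L2 eL, of j e k t] eL j k by force
      also have "\<dots> \<le> G * L2_norm \<Omega> (e k)"
        using start[of j] True j unfolding e_def[abs_def] by (intro mult_right_mono L2_norm_nonneg) auto
      finally show ?thesis using True by (simp add: F_def)
    next
      case False
      then have jk: "j \<in> {m..n}" "j \<le> n" "k \<le> n" using j k by auto
      have "L2_inner \<Omega> (\<lambda>x. \<kappa> x * e j x) (e k) \<le> L2_norm \<Omega> (\<lambda>x. \<kappa> x * e j x) * L2_norm \<Omega> (e k)"
        using L2_inner_le_norm[OF \<kappa>L[OF eL[OF jk(2)]] eL[OF jk(3)]] by simp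
      also have "\<dots> \<le> (\<kappa>s * L2_norm \<Omega> (e j)) * L2_norm \<Omega> (e k)"
        using \<kappa> by (intro mult_right_mono L2_norm_nonneg L2_norm_bounded_mult eL \<kappa>m jk) auto
      finally have "L2_inner \<Omega> (\<lambda>x. \<kappa> x * e j x) (e k) \<le> \<kappa>s * L2_norm \<Omega> (e j) * L2_norm \<Omega> (e k)" .
      moreover have "\<eta> j (e k) \<le> G * L2_norm \<Omega> (e k)"
        using consistency[OF jk(1) eL[OF jk(3)]] by (simp add: \<eta>_def)
      ultimately show ?thesis using False by (simp add: F_def distrib_right)
    qed
  qed (use m \<kappa> \<open>0 \<le> G\<close> in \<open>auto simp: L2_norm_nonneg L2_norm_power2\<close>)
  then show ?thesis by (simp add: e_def[abs_def])
qed

end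

context mesh
begin

text \<open>For j >= 2 the weights 1/2 of the BDF2 bound average two terms of the maximum, so B
  enters with factor 1. The maximum runs to n and not to j, which makes the bound uniform over the
  levels involved.\<close>

lemma solution_consistency:
  fixes \<Omega> :: "'a::euclidean_space set" and u :: "real \<Rightarrow> 'a \<Rightarrow> real"
  assumes u: "diffusion_solution \<Omega> \<epsilon> \<kappa> T f u0 u ut utt uttt" and w: "w \<in> L2 \<Omega>" and j: "1 \<le> j" "j \<le> n" "n \<le> N"
    and B: "B = Max ((\<lambda>j. step t j * integral {t (j - 1)..t j} (\<lambda>s. L2_norm \<Omega> (uttt s))) ` {1..n})"
  shows "\<bar>(\<Sum>i=1..j. bdf2_kernel t j (j - i) * (L2_inner \<Omega> (u (t i)) w - L2_inner \<Omega> (u (t (i - 1))) w))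
        - L2_inner \<Omega> (ut (t j)) w\<bar> \<le>
      (if j = 1 then integral {0..t 1} (\<lambda>s. L2_norm \<Omega> (utt s)) else B) * L2_norm \<Omega> w"
proof -
  have D: "L2_has_derivative_on \<Omega> {0..T} u ut" "L2_has_derivative_on \<Omega> {0..T} ut utt"
    "L2_has_derivative_on \<Omega> {0..T} utt uttt" and C3: "L2_continuous_on \<Omega> {0..T} uttt"
    using u by (auto simp: diffusion_solution_def)
  note d = L2_has_derivative_inner[OF D(1) w] L2_has_derivative_inner[OF D(2) w] L2_has_derivative_inner[OF D(3) w]
  have CS: "\<bar>L2_inner \<Omega> (v s) w\<bar> \<le> L2_norm \<Omega> (v s) * L2_norm \<Omega> w" if "v s \<in> L2 \<Omega>" for v :: "real \<Rightarrow> 'a \<Rightarrow> real" and s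
    by (rule L2_inner_le_norm[OF that w])
  show ?thesis
  proof (cases "j = 1")
    case True
    have t1: "0 < t 1" "t 1 \<le> T" using t_strict_mono[of 0 1] t_le_T[of 1] j by auto
    have "\<bar>(L2_inner \<Omega> (u (t 1)) w - L2_inner \<Omega> (u 0) w) / (t 1 - 0) - L2_inner \<Omega> (ut (t 1)) w\<bar> \<le>
        integral {0..t 1} (\<lambda>s. L2_norm \<Omega> (utt s) * L2_norm \<Omega> w)"
      using t1 L2_has_derivative_onD(2)[OF D(2)]
      by (intro bdf1_consistency[where I="{0..T}" and \<phi>''="\<lambda>s. L2_inner \<Omega> (utt s) w"] d CS
          continuous_intros L2_continuous_on_norm[OF L2_has_derivative_imp_continuous[OF D(3)]]) auto
    then show ?thesis using True by (simp add: bdf2_kernel_def step_def)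
  next
    case False
    with j have j2: "2 \<le> j" by simp
    have term_le: "step t i * integral {t (i - 1)..t i} (\<lambda>s. L2_norm \<Omega> (uttt s)) \<le> B" if "1 \<le> i" "i \<le> n" for i
      unfolding B using that by (intro Max_ge) auto
    have le: "step t j * integral {t (j - 1)..t j} (\<lambda>s. L2_norm \<Omega> (uttt s)) \<le> B"
      "step t (j - 1) * integral {t (j - 1 - 1)..t (j - 1)} (\<lambda>s. L2_norm \<Omega> (uttt s)) \<le> B"
      using j j2 by (intro term_le; simp)+
    have "\<bar>(\<Sum>i=1..j. bdf2_kernel t j (j - i) * (L2_inner \<Omega> (u (t i)) w - L2_inner \<Omega> (u (t (i - 1))) w))
        - L2_inner \<Omega> (ut (t j)) w\<bar> \<le>
        step t j / 2 * integral {t (j - 1)..t j} (\<lambda>s. L2_norm \<Omega> (uttt s) * L2_norm \<Omega> w) +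
        step t (j - 1) / 2 * integral {t (j - 1 - 1)..t (j - 1)} (\<lambda>s. L2_norm \<Omega> (uttt s) * L2_norm \<Omega> w)"
      using j j2 L2_has_derivative_onD(2)[OF D(3)]
      by (intro bdf2_consistency[where \<phi>="\<lambda>s. L2_inner \<Omega> (u s) w" and \<phi>'="\<lambda>s. L2_inner \<Omega> (ut s) w"
            and \<phi>''="\<lambda>s. L2_inner \<Omega> (utt s) w" and \<phi>'''="\<lambda>s. L2_inner \<Omega> (uttt s) w"] d CS
          continuous_intros L2_continuous_on_norm[OF C3]) auto
    also have "\<dots> = (step t j * integral {t (j - 1)..t j} (\<lambda>s. L2_norm \<Omega> (uttt s)) +
        step t (j - 1) * integral {t (j - 1 - 1)..t (j - 1)} (\<lambda>s. L2_norm \<Omega> (uttt s))) / 2 * L2_norm \<Omega> w"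
      by (simp add: algebra_simps)
    also have "\<dots> \<le> B * L2_norm \<Omega> w"
      using le by (intro mult_right_mono L2_norm_nonneg) simp
    finally show ?thesis using False by simp
  qed
qed

end

theorem theorem3p3:
  fixes \<Omega> :: "'a::euclidean_space set"
    and \<epsilon> \<kappa>s T :: real
    and \<kappa> u0 :: "'a \<Rightarrow> real"
    and f u ut utt uttt :: "real \<Rightarrow> 'a \<Rightarrow> real"
    and N :: nat
    and t :: "nat \<Rightarrow> real"
  assumes "open \<Omega>" "\<Omega> \<noteq> {}" "bounded \<Omega>" "convex \<Omega>" "smooth_boundary \<Omega>"
    and "\<epsilon> > 0"
    and "smooth_on \<Omega> \<kappa>" "\<kappa>s > 0" "\<forall>x\<in>\<Omega>. \<bar>\<kappa> x\<bar> \<le> \<kappa>s"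
    and "T > 0"
    and "L2_continuous_on \<Omega> {0..T} f"
    and "diffusion_solution \<Omega> \<epsilon> \<kappa> T f u0 u ut utt uttt"
    and "time_mesh T N t"
    and "bdf2_kernels_psd N t \<or> (\<forall>k\<in>{2..N}. 0 < ratio t k \<and> ratio t k \<le> (3 + sqrt 17) / 2)"
    and "Max (step t ` {1..N}) \<le> 1 / (4 * \<kappa>s)"
  shows
    "(\<forall>U. adaptive_bdf2 1 \<Omega> \<epsilon> \<kappa> f N t U \<longrightarrow>
       (\<forall>n\<in>{1..N}.
          L2_norm \<Omega> (\<lambda>x. u (t n) x - U n x) \<le>
          2 * exp (4 * \<kappa>s * t (n - 1)) *
            (L2_norm \<Omega> (\<lambda>x. u0 x - U 0 x)
             + 2 * t n * integral {0..t 1} (\<lambda>s. L2_norm \<Omega> (utt s))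
             + 3 * t n * Max ((\<lambda>j. step t j * integral {t (j - 1)..t j} (\<lambda>s. L2_norm \<Omega> (uttt s))) ` {1..n}))))
     \<and>
     (\<forall>U. adaptive_bdf2 2 \<Omega> \<epsilon> \<kappa> f N t U \<longrightarrow>
       (\<forall>n\<in>{2..N}.
          L2_norm \<Omega> (\<lambda>x. u (t n) x - U n x) \<le>
          2 * exp (4 * \<kappa>s * t (n - 1)) *
            (L2_norm \<Omega> (\<lambda>x. u (t 1) x - U 1 x)
             + 2 * t n * L2_norm \<Omega> (\<lambda>x. ((u (t 1) x - U 1 x) - (u (t 0) x - U 0 x)) / step t 1)
             + 3 * t n * Max ((\<lambda>j. step t j * integral {t (j - 1)..t j} (\<lambda>s. L2_norm \<Omega> (uttt s))) ` {1..n}))))"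
proof -
  interpret mesh T N t by unfold_locales fact
  define B where "B n = Max ((\<lambda>j. step t j * integral {t (j - 1)..t j} (\<lambda>s. L2_norm \<Omega> (uttt s))) ` {1..n})" for n
  define I where "I = integral {0..t 1} (\<lambda>s. L2_norm \<Omega> (utt s))"
  note \<Omega> = \<open>open \<Omega>\<close> \<open>bounded \<Omega>\<close> and u = \<open>diffusion_solution \<Omega> \<epsilon> \<kappa> T f u0 u ut utt uttt\<close>
  have "Ck_on 0 \<Omega> \<kappa>" using \<open>smooth_on \<Omega> \<kappa>\<close> by (simp only: smooth_on_def)
  then have \<kappa>: "continuous_on \<Omega> \<kappa>" by simp
  have fL: "\<forall>s\<in>{0..T}. f s \<in> L2 \<Omega>"
    using \<open>L2_continuous_on \<Omega> {0..T} f\<close> by (simp add: L2_continuous_on_def)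
  have psd: "bdf2_kernels_psd N t"
    using \<open>bdf2_kernels_psd N t \<or> _\<close> bdf2_kernels_psd_of_ratio by blast
  have small: "\<forall>k\<in>{1..N}. step t k \<le> 1 / (4 * \<kappa>s)"
    using \<open>Max (step t ` {1..N}) \<le> _\<close> by (meson Max_ge finite_atLeastAtMost finite_imageI imageI order_trans)
  note bound = error_bound[OF \<Omega> \<open>\<epsilon> > 0\<close> \<kappa> \<open>\<kappa>s > 0\<close> \<open>\<forall>x\<in>\<Omega>. \<bar>\<kappa> x\<bar> \<le> \<kappa>s\<close> fL u psd small]
  \<comment> \<open>The integral of a non-integrable function is 0 by convention, so both cases give
    the sign.\<close>
  have I0: "0 \<le> I"
  proof (cases "(\<lambda>s. L2_norm \<Omega> (utt s)) integrable_on {0..t 1}")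
    case True
    then show ?thesis by (simp add: I_def integral_nonneg L2_norm_nonneg)
  qed (simp add: I_def not_integrable_integral)
  have B0: "0 \<le> B n" if n: "1 \<le> n" "n \<le> N" for n
  proof -
    have "L2_continuous_on \<Omega> {0..T} uttt" using u by (simp add: diffusion_solution_def)
    then have "continuous_on {0..t 1} (\<lambda>s. L2_norm \<Omega> (uttt s))"
      using t_le_T[of 1] n by (intro continuous_on_subset[OF L2_continuous_on_norm]) auto
    then have "0 \<le> integral {0..t 1} (\<lambda>s. L2_norm \<Omega> (uttt s))"
      by (intro integral_nonneg integrable_continuous_real) (auto simp: L2_norm_nonneg)
    then have "0 \<le> step t 1 * integral {t (1 - 1)..t 1} (\<lambda>s. L2_norm \<Omega> (uttt s))"
      using step_pos[of 1] n by simp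
    also have "\<dots> \<le> B n" unfolding B_def using n by (intro Max_ge image_eqI[where x=1]) auto
    finally show ?thesis .
  qed
  \<comment> \<open>Stability yields the coefficient 2 in front of t n * B n; this product is
    nonnegative, so 3 is also admissible.\<close>
  have final: "2 * exp (4 * \<kappa>s * t (n - 1)) * (a + 2 * t n * (J + B n)) \<le>
      2 * exp (4 * \<kappa>s * t (n - 1)) * (a + 2 * t n * J + 3 * t n * B n)" if n: "1 \<le> n" "n \<le> N" for n a J
  proof -
    have "0 \<le> t n * B n" using n by (intro mult_nonneg_nonneg B0 t_nonneg)
    then show ?thesis by (intro mult_left_mono) (auto simp: algebra_simps)
  qed
  show ?thesis unfolding B_def[symmetric] I_def[symmetric]
  proof (intro conjI allI impI ballI)
    fix U n assume U: "adaptive_bdf2 1 \<Omega> \<epsilon> \<kappa> f N t U" and "n \<in> {1..N}"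
    then have n: "1 \<le> n" "n \<le> N" by auto
    have "L2_norm \<Omega> (\<lambda>x. u (t n) x - U n x) \<le>
        2 * exp (4 * \<kappa>s * t (n - 1)) * (L2_norm \<Omega> (\<lambda>x. u (t (1 - 1)) x - U (1 - 1) x) + 2 * t n * (I + B n))"
    \<comment> \<open>For m = 1 the condition on levels below m is vacuous. The source bound I + B n
      dominates the first-level bound I as well as the later bound B n.\<close>
    proof (rule bound[OF U])
      fix j and w :: "'a \<Rightarrow> real" assume j: "j \<in> {1..n}" and w: "w \<in> L2 \<Omega>"
      have "(if j = 1 then I else B n) * L2_norm \<Omega> w \<le> (I + B n) * L2_norm \<Omega> w"
        using I0 B0[OF n] by (intro mult_right_mono L2_norm_nonneg) auto
      then show "\<bar>(\<Sum>i=1..j. bdf2_kernel t j (j - i) * (L2_inner \<Omega> (u (t i)) w - L2_inner \<Omega> (u (t (i - 1))) w))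
          - L2_inner \<Omega> (ut (t j)) w\<bar> \<le> (I + B n) * L2_norm \<Omega> w"
        using solution_consistency[OF u w _ _ n(2) B_def, of j] j unfolding I_def[symmetric] by force
    qed (use n I0 B0[OF n] in auto)
    also have "\<dots> \<le> 2 * exp (4 * \<kappa>s * t (n - 1)) *
        (L2_norm \<Omega> (\<lambda>x. u (t (1 - 1)) x - U (1 - 1) x) + 2 * t n * I + 3 * t n * B n)"
      by (rule final[OF n])
    also have "L2_norm \<Omega> (\<lambda>x. u (t (1 - 1)) x - U (1 - 1) x) = L2_norm \<Omega> (\<lambda>x. u0 x - U 0 x)"
    proof -
      have uL: "u 0 \<in> L2 \<Omega>" and eq: "AE x in lebesgue_on \<Omega>. u 0 x = u0 x"
        using u \<open>T > 0\<close> by (auto simp: diffusion_solution_def L2_has_derivative_on_def)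
      have UL: "U 0 \<in> L2 \<Omega>" using U by (simp add: adaptive_bdf2_def)
      have u0L: "u0 \<in> L2 \<Omega>" using \<open>open \<Omega>\<close> by (intro L2_cong_AE[OF _ uL eq]) auto
      have "L2_norm \<Omega> (\<lambda>x. u 0 x - U 0 x) = L2_norm \<Omega> (\<lambda>x. u0 x - U 0 x)"
        using eq by (intro L2_norm_cong_AE L2_diff uL u0L UL) auto
      then show ?thesis by simp
    qed
    finally show "L2_norm \<Omega> (\<lambda>x. u (t n) x - U n x) \<le> 2 * exp (4 * \<kappa>s * t (n - 1)) *
        (L2_norm \<Omega> (\<lambda>x. u0 x - U 0 x) + 2 * t n * I + 3 * t n * B n)" .
  next
    fix U n assume U: "adaptive_bdf2 2 \<Omega> \<epsilon> \<kappa> f N t U" and "n \<in> {2..N}"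
    then have n: "1 \<le> n" "2 \<le> n" "n \<le> N" by auto
    \<comment> \<open>At level 1 \<open>D2\<close> of the error is exactly this quotient, so J is
      the source bound for the one level without an equation.\<close>
    define J where "J = L2_norm \<Omega> (\<lambda>x. ((u (t 1) x - U 1 x) - (u (t 0) x - U 0 x)) / step t 1)"
    have J0: "0 \<le> J" by (simp add: J_def L2_norm_nonneg)
    have "L2_norm \<Omega> (\<lambda>x. u (t n) x - U n x) \<le>
        2 * exp (4 * \<kappa>s * t (n - 1)) * (L2_norm \<Omega> (\<lambda>x. u (t (2 - 1)) x - U (2 - 1) x) + 2 * t n * (J + B n))"
    proof (rule bound[OF U])
      fix j and w :: "'a \<Rightarrow> real" assume j: "j \<in> {2..n}" and w: "w \<in> L2 \<Omega>"
      have "B n * L2_norm \<Omega> w \<le> (J + B n) * L2_norm \<Omega> w"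
        using J0 by (intro mult_right_mono L2_norm_nonneg) auto
      then show "\<bar>(\<Sum>i=1..j. bdf2_kernel t j (j - i) * (L2_inner \<Omega> (u (t i)) w - L2_inner \<Omega> (u (t (i - 1))) w))
          - L2_inner \<Omega> (ut (t j)) w\<bar> \<le> (J + B n) * L2_norm \<Omega> w"
        using solution_consistency[OF u w _ _ n(3) B_def, of j] j by force
    next
      fix j :: nat assume "1 \<le> j" "j < 2"
      then have "D2 t (\<lambda>k x. u (t k) x - U k x) j = (\<lambda>x. ((u (t 1) x - U 1 x) - (u (t 0) x - U 0 x)) / step t 1)"
        by (auto simp: D2_def bdf2_kernel_def less_2_cases_iff)
      then show "L2_norm \<Omega> (D2 t (\<lambda>k x. u (t k) x - U k x) j) \<le> J + B n"
        using B0[OF n(1,3)] by (simp add: J_def)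
    qed (use n J0 B0[OF n(1,3)] in auto)
    also have "\<dots> \<le> 2 * exp (4 * \<kappa>s * t (n - 1)) *
        (L2_norm \<Omega> (\<lambda>x. u (t (2 - 1)) x - U (2 - 1) x) + 2 * t n * J + 3 * t n * B n)"
      by (rule final[OF n(1,3)])
    finally show "L2_norm \<Omega> (\<lambda>x. u (t n) x - U n x) \<le> 2 * exp (4 * \<kappa>s * t (n - 1)) *
        (L2_norm \<Omega> (\<lambda>x. u (t 1) x - U 1 x) +
         2 * t n * L2_norm \<Omega> (\<lambda>x. ((u (t 1) x - U 1 x) - (u (t 0) x - U 0 x)) / step t 1) + 3 * t n * B n)"
      by (simp add: J_def)
  qed
qed

end
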